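(* For each $n\in\mathbb{N}$ (including $n=0$), the subcategories $\mathcal{M}_{\geq n+1}$ and $\mathcal{T}_{tr_n}$ of $Simp(Grp)$ are equivalent. Moreover, $\mathcal{M}_{\geq n+1}$ is a torsion subcategory of $Simp(Grp)$, with $$(\mathcal{T}_{tr_n},\mathcal{F}_{tr_n})\cong(\mathcal{M}_{\geq n+1},\mathcal{F}_{tr_n}).$$
   Context: $Simp(Grp)$ is the category of simplicial groups, with face maps $d_i$. The Moore complex $N(X)$ of a simplicial group $X$ is $N(X)_0=X_0$, $N(X)_k=\bigcap_{i=0}^{k-1}\ker(d_i:X_k\to X_{k-1})$ for $k\ge 1$, with differential the restriction of $d_k$. $\mathcal{M}_{\geq n+1}$ is the full subcategory of simplicial groups $X$ with $N(X)_i=0$ for all $i\le n$. $tr_n$ is the truncation functor from simplicial groups to $n$-truncated simplicial groups, and $cosk_n$ is its right adjoint. $\mathcal{T}_{tr_n}$ is the full subcategory of simplicial groups $X$ with $tr_n(X)\cong 0$ (i.e. $X_i=0$ for $i\le n$), and $\mathcal{F}_{tr_n}$ is the full subcategory of simplicial groups $X$ for which the unit $X\to cosk_n tr_n(X)$ is a monomorphism. A torsion theory in a semi-abelian category is a pair $(\mathcal{T},\mathcal{F})$ of full replete subcategories such that every morphism $T\to F$ with $T\in\mathcal{T}$, $F\in\mathcal{F}$ is zero, and every object $X$ admits a short exact sequence $0\to T_X\to X\to F_X\to 0$ with $T_X\in\mathcal{T}$, $F_X\in\mathcal{F}$; $\mathcal{T}$ is then called a torsion subcategory. *)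

theory Defs
  imports "HOL-Algebra.Coset"
begin

section \<open>Categories\<close>

text \<open>
  A category is given by hom-sets. \<open>Comp C X Y Z g f\<close> is the composite of
  \<open>f \<in> Hom C X Y\<close> and \<open>g \<in> Hom C Y Z\<close>.
\<close>

record ('o, 'm) cat =
  Ob :: "'o set"
  Hom :: "'o \<Rightarrow> 'o \<Rightarrow> 'm set"
  Ident :: "'o \<Rightarrow> 'm"
  Comp :: "'o \<Rightarrow> 'o \<Rightarrow> 'o \<Rightarrow> 'm \<Rightarrow> 'm \<Rightarrow> 'm"

definition is_category :: "('o, 'm) cat \<Rightarrow> bool" where
  "is_category C \<longleftrightarrow>
     (\<forall>X\<in>Ob C. Ident C X \<in> Hom C X X) \<and>
     (\<forall>X\<in>Ob C. \<forall>Y\<in>Ob C. \<forall>Z\<in>Ob C. \<forall>f\<in>Hom C X Y. \<forall>g\<in>Hom C Y Z.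
        Comp C X Y Z g f \<in> Hom C X Z) \<and>
     (\<forall>X\<in>Ob C. \<forall>Y\<in>Ob C. \<forall>f\<in>Hom C X Y.
        Comp C X Y Y (Ident C Y) f = f \<and> Comp C X X Y f (Ident C X) = f) \<and>
     (\<forall>W\<in>Ob C. \<forall>X\<in>Ob C. \<forall>Y\<in>Ob C. \<forall>Z\<in>Ob C.
        \<forall>f\<in>Hom C W X. \<forall>g\<in>Hom C X Y. \<forall>h\<in>Hom C Y Z.
        Comp C W Y Z h (Comp C W X Y g f) = Comp C W X Z (Comp C X Y Z h g) f)"

definition full_sub :: "('o, 'm) cat \<Rightarrow> 'o set \<Rightarrow> ('o, 'm) cat" where
  "full_sub C S = C\<lparr>Ob := Ob C \<inter> S\<rparr>"

definition is_iso :: "('o, 'm) cat \<Rightarrow> 'o \<Rightarrow> 'o \<Rightarrow> 'm \<Rightarrow> bool" where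
  "is_iso C X Y f \<longleftrightarrow> f \<in> Hom C X Y \<and>
     (\<exists>g\<in>Hom C Y X. Comp C X Y X g f = Ident C X \<and> Comp C Y X Y f g = Ident C Y)"

definition isomorphic :: "('o, 'm) cat \<Rightarrow> 'o \<Rightarrow> 'o \<Rightarrow> bool" where
  "isomorphic C X Y \<longleftrightarrow> (\<exists>f. is_iso C X Y f)"

definition is_mono :: "('o, 'm) cat \<Rightarrow> 'o \<Rightarrow> 'o \<Rightarrow> 'm \<Rightarrow> bool" where
  "is_mono C X Y f \<longleftrightarrow> f \<in> Hom C X Y \<and>
     (\<forall>Z\<in>Ob C. \<forall>g\<in>Hom C Z X. \<forall>h\<in>Hom C Z X.
        Comp C Z X Y f g = Comp C Z X Y f h \<longrightarrow> g = h)"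

definition is_zero :: "('o, 'm) cat \<Rightarrow> 'o \<Rightarrow> bool" where
  "is_zero C Z \<longleftrightarrow> Z \<in> Ob C \<and>
     (\<forall>X\<in>Ob C. (\<exists>!f. f \<in> Hom C X Z) \<and> (\<exists>!f. f \<in> Hom C Z X))"

definition zero_mor :: "('o, 'm) cat \<Rightarrow> 'o \<Rightarrow> 'o \<Rightarrow> 'm \<Rightarrow> bool" where
  "zero_mor C X Y f \<longleftrightarrow>
     (\<exists>Z a b. is_zero C Z \<and> a \<in> Hom C X Z \<and> b \<in> Hom C Z Y \<and> f = Comp C X Z Y b a)"

definition is_kernel :: "('o, 'm) cat \<Rightarrow> 'o \<Rightarrow> 'o \<Rightarrow> 'o \<Rightarrow> 'm \<Rightarrow> 'm \<Rightarrow> bool" where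
  "is_kernel C A X Y k f \<longleftrightarrow>
     k \<in> Hom C A X \<and> f \<in> Hom C X Y \<and> zero_mor C A Y (Comp C A X Y f k) \<and>
     (\<forall>Z\<in>Ob C. \<forall>g\<in>Hom C Z X. zero_mor C Z Y (Comp C Z X Y f g) \<longrightarrow>
        (\<exists>!u. u \<in> Hom C Z A \<and> g = Comp C Z A X k u))"

definition is_cokernel :: "('o, 'm) cat \<Rightarrow> 'o \<Rightarrow> 'o \<Rightarrow> 'o \<Rightarrow> 'm \<Rightarrow> 'm \<Rightarrow> bool" where
  "is_cokernel C X Y B f q \<longleftrightarrow>
     f \<in> Hom C X Y \<and> q \<in> Hom C Y B \<and> zero_mor C X B (Comp C X Y B q f) \<and>
     (\<forall>Z\<in>Ob C. \<forall>g\<in>Hom C Y Z. zero_mor C X Z (Comp C X Y Z g f) \<longrightarrow>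
        (\<exists>!u. u \<in> Hom C B Z \<and> g = Comp C Y B Z u q))"

text \<open>\<open>0 \<longrightarrow> A \<longrightarrow> X \<longrightarrow> B \<longrightarrow> 0\<close> with maps \<open>t\<close> and \<open>q\<close>.\<close>

definition short_exact :: "('o, 'm) cat \<Rightarrow> 'o \<Rightarrow> 'o \<Rightarrow> 'o \<Rightarrow> 'm \<Rightarrow> 'm \<Rightarrow> bool" where
  "short_exact C A X B t q \<longleftrightarrow> is_kernel C A X B t q \<and> is_cokernel C A X B t q"

subsection \<open>Functors, adjunctions and equivalences\<close>

record ('o, 'm, 'p, 'q) cfunctor =
  on_ob :: "'o \<Rightarrow> 'p"
  on_hom :: "'o \<Rightarrow> 'o \<Rightarrow> 'm \<Rightarrow> 'q"

definition is_functor :: "('o, 'm) cat \<Rightarrow> ('p, 'q) cat \<Rightarrow> ('o, 'm, 'p, 'q) cfunctor \<Rightarrow> bool" where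
  "is_functor C D F \<longleftrightarrow> is_category C \<and> is_category D \<and>
     (\<forall>X\<in>Ob C. on_ob F X \<in> Ob D) \<and>
     (\<forall>X\<in>Ob C. \<forall>Y\<in>Ob C. \<forall>f\<in>Hom C X Y. on_hom F X Y f \<in> Hom D (on_ob F X) (on_ob F Y)) \<and>
     (\<forall>X\<in>Ob C. on_hom F X X (Ident C X) = Ident D (on_ob F X)) \<and>
     (\<forall>X\<in>Ob C. \<forall>Y\<in>Ob C. \<forall>Z\<in>Ob C. \<forall>f\<in>Hom C X Y. \<forall>g\<in>Hom C Y Z.
        on_hom F X Z (Comp C X Y Z g f) =
        Comp D (on_ob F X) (on_ob F Y) (on_ob F Z) (on_hom F Y Z g) (on_hom F X Y f))"

definition functor_id :: "('o, 'm, 'o, 'm) cfunctor" where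
  "functor_id = \<lparr>on_ob = (\<lambda>X. X), on_hom = (\<lambda>X Y f. f)\<rparr>"

definition functor_comp ::
    "('p, 'q, 'r, 's) cfunctor \<Rightarrow> ('o, 'm, 'p, 'q) cfunctor \<Rightarrow> ('o, 'm, 'r, 's) cfunctor" where
  "functor_comp G F = \<lparr>on_ob = (\<lambda>X. on_ob G (on_ob F X)),
     on_hom = (\<lambda>X Y f. on_hom G (on_ob F X) (on_ob F Y) (on_hom F X Y f))\<rparr>"

definition nat_trans :: "('o, 'm) cat \<Rightarrow> ('p, 'q) cat \<Rightarrow>
    ('o, 'm, 'p, 'q) cfunctor \<Rightarrow> ('o, 'm, 'p, 'q) cfunctor \<Rightarrow> ('o \<Rightarrow> 'q) \<Rightarrow> bool" where
  "nat_trans C D F G \<tau> \<longleftrightarrow> is_functor C D F \<and> is_functor C D G \<and>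
     (\<forall>X\<in>Ob C. \<tau> X \<in> Hom D (on_ob F X) (on_ob G X)) \<and>
     (\<forall>X\<in>Ob C. \<forall>Y\<in>Ob C. \<forall>f\<in>Hom C X Y.
        Comp D (on_ob F X) (on_ob F Y) (on_ob G Y) (\<tau> Y) (on_hom F X Y f) =
        Comp D (on_ob F X) (on_ob G X) (on_ob G Y) (on_hom G X Y f) (\<tau> X))"

definition naturally_isomorphic :: "('o, 'm) cat \<Rightarrow> ('p, 'q) cat \<Rightarrow>
    ('o, 'm, 'p, 'q) cfunctor \<Rightarrow> ('o, 'm, 'p, 'q) cfunctor \<Rightarrow> bool" where
  "naturally_isomorphic C D F G \<longleftrightarrow>
     (\<exists>\<tau>. nat_trans C D F G \<tau> \<and> (\<forall>X\<in>Ob C. is_iso D (on_ob F X) (on_ob G X) (\<tau> X)))"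

definition is_equivalence :: "('o, 'm) cat \<Rightarrow> ('p, 'q) cat \<Rightarrow>
    ('o, 'm, 'p, 'q) cfunctor \<Rightarrow> ('p, 'q, 'o, 'm) cfunctor \<Rightarrow> bool" where
  "is_equivalence C D F G \<longleftrightarrow> is_functor C D F \<and> is_functor D C G \<and>
     naturally_isomorphic C C functor_id (functor_comp G F) \<and> naturally_isomorphic D D (functor_comp F G) functor_id"

text \<open>\<open>G\<close> is right adjoint to \<open>F\<close> with unit \<open>\<eta>\<close>: every \<open>\<eta> X\<close> is universal from \<open>X\<close> to \<open>G\<close>.\<close>

definition right_adjoint :: "('o, 'm) cat \<Rightarrow> ('p, 'q) cat \<Rightarrow> ('o, 'm, 'p, 'q) cfunctor \<Rightarrow>
    ('p, 'q, 'o, 'm) cfunctor \<Rightarrow> ('o \<Rightarrow> 'm) \<Rightarrow> bool" where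
  "right_adjoint C D F G \<eta> \<longleftrightarrow> is_functor C D F \<and> is_functor D C G \<and>
     nat_trans C C functor_id (functor_comp G F) \<eta> \<and>
     (\<forall>X\<in>Ob C. \<forall>Y\<in>Ob D. \<forall>g\<in>Hom C X (on_ob G Y).
        \<exists>!f. f \<in> Hom D (on_ob F X) Y \<and>
          g = Comp C X (on_ob G (on_ob F X)) (on_ob G Y) (on_hom G (on_ob F X) Y f) (\<eta> X))"

text \<open>
  Equivalence of the full subcategories on \<open>S\<close> and \<open>T\<close>, as subcategories of \<open>C\<close>: an equivalence
  commuting with the inclusions into \<open>C\<close> up to natural isomorphism. On underlying data the
  inclusion is \<open>functor_id\<close>, so \<open>F\<close> followed by the inclusion of \<open>T\<close> is written \<open>functor_comp functor_id F\<close>.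
\<close>

definition equivalent_subcats :: "('o, 'm) cat \<Rightarrow> 'o set \<Rightarrow> 'o set \<Rightarrow> bool" where
  "equivalent_subcats C S T \<longleftrightarrow>
     (\<exists>F G. is_equivalence (full_sub C S) (full_sub C T) F G \<and>
        naturally_isomorphic (full_sub C S) C (functor_comp functor_id F) functor_id)"

subsection \<open>Torsion theories\<close>

definition replete :: "('o, 'm) cat \<Rightarrow> 'o set \<Rightarrow> bool" where
  "replete C S \<longleftrightarrow> (\<forall>X\<in>S. \<forall>Y\<in>Ob C. isomorphic C X Y \<longrightarrow> Y \<in> S)"

definition torsion_theory :: "('o, 'm) cat \<Rightarrow> 'o set \<Rightarrow> 'o set \<Rightarrow> bool" where
  "torsion_theory C T F \<longleftrightarrow> is_category C \<and> (\<exists>Z. is_zero C Z) \<and>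
     T \<subseteq> Ob C \<and> F \<subseteq> Ob C \<and> replete C T \<and> replete C F \<and>
     (\<forall>X\<in>T. \<forall>Y\<in>F. \<forall>f\<in>Hom C X Y. zero_mor C X Y f) \<and>
     (\<forall>X\<in>Ob C. \<exists>A\<in>T. \<exists>B\<in>F. \<exists>t q. short_exact C A X B t q)"

definition torsion_subcategory :: "('o, 'm) cat \<Rightarrow> 'o set \<Rightarrow> bool" where
  "torsion_subcategory C T \<longleftrightarrow> (\<exists>F. torsion_theory C T F)"

definition torsion_theories_iso ::
    "('o, 'm) cat \<Rightarrow> 'o set \<times> 'o set \<Rightarrow> 'o set \<times> 'o set \<Rightarrow> bool" where
  "torsion_theories_iso C P Q \<longleftrightarrow>
     torsion_theory C (fst P) (snd P) \<and> torsion_theory C (fst Q) (snd Q) \<and>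
     equivalent_subcats C (fst P) (fst Q) \<and> equivalent_subcats C (snd P) (snd Q)"

section \<open>Simplicial groups\<close>

text \<open>
  \<open>Delta k l\<close> is the set of morphisms \<open>[k] \<rightarrow> [l]\<close> of the simplex category.
\<close>

definition Delta :: "nat \<Rightarrow> nat \<Rightarrow> (nat \<Rightarrow> nat) set" where
  "Delta k l = {\<theta> \<in> {..k} \<rightarrow>\<^sub>E {..l}. mono_on {..k} \<theta>}"

definition coface :: "nat \<Rightarrow> nat \<Rightarrow> nat \<Rightarrow> nat" where
  "coface k i = (\<lambda>j\<in>{..k - 1}. if j < i then j else Suc j)"

text \<open>
  \<open>act X k l \<theta>\<close> is the map \<open>X\<^sub>l \<rightarrow> X\<^sub>k\<close> induced by \<open>\<theta> : [k] \<rightarrow> [l]\<close>. With \<open>D = UNIV\<close> the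
  predicate below describes functors from the opposite of the simplex category to groups, and with
  \<open>D = {..n}\<close> it describes \<open>n\<close>-truncated simplicial groups. The type \<open>'a\<close> is the universe
  in which all underlying sets live.
\<close>

record 'a simplicial =
  grp :: "nat \<Rightarrow> 'a monoid"
  act :: "nat \<Rightarrow> nat \<Rightarrow> (nat \<Rightarrow> nat) \<Rightarrow> 'a \<Rightarrow> 'a"

definition simplicial_group_on :: "nat set \<Rightarrow> 'a simplicial \<Rightarrow> bool" where
  "simplicial_group_on D X \<longleftrightarrow>
     (\<forall>k\<in>D. group (grp X k)) \<and>
     (\<forall>k\<in>D. \<forall>l\<in>D. \<forall>\<theta>\<in>Delta k l. act X k l \<theta> \<in> hom (grp X l) (grp X k)) \<and>
     (\<forall>k\<in>D. \<forall>x\<in>carrier (grp X k). act X k k (\<lambda>j\<in>{..k}. j) x = x) \<and>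
     (\<forall>j\<in>D. \<forall>k\<in>D. \<forall>l\<in>D. \<forall>\<theta>\<in>Delta j k. \<forall>\<phi>\<in>Delta k l. \<forall>x\<in>carrier (grp X l).
        act X j l (compose {..j} \<phi> \<theta>) x = act X j k \<theta> (act X k l \<phi> x))"

text \<open>
  Simplicial maps are made extensional, so that equality in \<open>Hom\<close> is equality of maps on carriers.
\<close>

definition simplicial_hom ::
    "nat set \<Rightarrow> 'a simplicial \<Rightarrow> 'a simplicial \<Rightarrow> (nat \<Rightarrow> 'a \<Rightarrow> 'a) set" where
  "simplicial_hom D X Y =
     {f \<in> (\<Pi>\<^sub>E k\<in>D. hom (grp X k) (grp Y k) \<inter> extensional (carrier (grp X k))).
        \<forall>k\<in>D. \<forall>l\<in>D. \<forall>\<theta>\<in>Delta k l. \<forall>x\<in>carrier (grp X l).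
          f k (act X k l \<theta> x) = act Y k l \<theta> (f l x)}"

definition SimpGrp_on :: "nat set \<Rightarrow> ('a simplicial, nat \<Rightarrow> 'a \<Rightarrow> 'a) cat" where
  "SimpGrp_on D =
     \<lparr>Ob = {X. simplicial_group_on D X},
      Hom = simplicial_hom D,
      Ident = (\<lambda>X. \<lambda>k\<in>D. \<lambda>x\<in>carrier (grp X k). x),
      Comp = (\<lambda>X Y Z g f. \<lambda>k\<in>D. compose (carrier (grp X k)) (g k) (f k))\<rparr>"

abbreviation SimpGrp :: "('a simplicial, nat \<Rightarrow> 'a \<Rightarrow> 'a) cat" where
  "SimpGrp \<equiv> SimpGrp_on UNIV"

abbreviation TrSimpGrp :: "nat \<Rightarrow> ('a simplicial, nat \<Rightarrow> 'a \<Rightarrow> 'a) cat" where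
  "TrSimpGrp n \<equiv> SimpGrp_on {..n}"

definition tr :: "nat \<Rightarrow>
    ('a simplicial, nat \<Rightarrow> 'a \<Rightarrow> 'a, 'a simplicial, nat \<Rightarrow> 'a \<Rightarrow> 'a) cfunctor" where
  "tr n =
     \<lparr>on_ob = (\<lambda>X. \<lparr>grp = restrict (grp X) {..n}, act = (\<lambda>k\<in>{..n}. \<lambda>l\<in>{..n}. act X k l)\<rparr>),
      on_hom = (\<lambda>X Y f. restrict f {..n})\<rparr>"

definition face :: "'a simplicial \<Rightarrow> nat \<Rightarrow> nat \<Rightarrow> 'a \<Rightarrow> 'a" where
  "face X k i = act X (k - 1) k (coface k i)"

definition moore :: "'a simplicial \<Rightarrow> nat \<Rightarrow> 'a monoid" where
  "moore X k = (grp X k)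
     \<lparr>carrier := (if k = 0 then carrier (grp X 0)
                 else \<Inter>i\<in>{..k - 1}. kernel (grp X k) (grp X (k - 1)) (face X k i))\<rparr>"

text \<open>\<open>M_ge m\<close> consists of the \<open>X\<close> with \<open>N(X)\<^sub>i = 0\<close> for all \<open>i < m\<close>.\<close>

definition M_ge :: "nat \<Rightarrow> 'a simplicial set" where
  "M_ge m = {X \<in> Ob SimpGrp. \<forall>i<m. carrier (moore X i) = {\<one>\<^bsub>moore X i\<^esub>}}"

definition T_tr :: "nat \<Rightarrow> 'a simplicial set" where
  "T_tr n = {X \<in> Ob SimpGrp. \<exists>Z. is_zero (TrSimpGrp n) Z \<and>
                isomorphic (TrSimpGrp n) (on_ob (tr n) X) Z}"

text \<open>Here \<open>cosk\<close> and \<open>\<eta>\<close> stand for a right adjoint of \<open>tr n\<close> and its unit.\<close>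

definition F_tr :: "nat \<Rightarrow>
    ('a simplicial, nat \<Rightarrow> 'a \<Rightarrow> 'a, 'a simplicial, nat \<Rightarrow> 'a \<Rightarrow> 'a) cfunctor \<Rightarrow>
    ('a simplicial \<Rightarrow> nat \<Rightarrow> 'a \<Rightarrow> 'a) \<Rightarrow> 'a simplicial set" where
  "F_tr n cosk \<eta> =
     {X \<in> Ob SimpGrp. is_mono SimpGrp X (on_ob cosk (on_ob (tr n) X)) (\<eta> X)}"

section \<open>Existence of the right adjoint\<close>

text \<open>
  For infinite \<open>'a\<close> the universe is closed under the finite limits defining the coskeleton, so
  \<open>tr n\<close> has a right adjoint: an element of degree \<open>k\<close> of the coskeleton of \<open>Y\<close> is a compatible
  family indexed by the maps \<open>[i] \<rightarrow> [k]\<close> with \<open>i \<le> n\<close>, stored in \<open>'a\<close> by means of an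
  injection.
\<close>

lemma Delta_id: "(\<lambda>j\<in>{..k}. j) \<in> Delta k k"
  by (auto simp: Delta_def mono_on_def)

lemma Delta_compose: "\<theta> \<in> Delta j k \<Longrightarrow> \<phi> \<in> Delta k l \<Longrightarrow> compose {..j} \<phi> \<theta> \<in> Delta j l"
  by (auto simp: Delta_def mono_on_def compose_def PiE_def Pi_def)

lemma Delta_compose_id: "\<theta> \<in> Delta k l \<Longrightarrow> compose {..k} \<theta> (\<lambda>j\<in>{..k}. j) = \<theta>"
  by (fastforce simp: Delta_def compose_def PiE_def extensional_def)

lemma Delta_id_compose: "\<theta> \<in> Delta k l \<Longrightarrow> compose {..k} (\<lambda>j\<in>{..l}. j) \<theta> = \<theta>"
  by (fastforce simp: Delta_def compose_def PiE_def extensional_def Pi_def)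

lemma Delta_assoc:
  "\<theta> \<in> Delta i j \<Longrightarrow> compose {..i} (compose {..j} \<psi> \<phi>) \<theta> = compose {..i} \<psi> (compose {..i} \<phi> \<theta>)"
  by (auto simp: Delta_def compose_def PiE_def Pi_def fun_eq_iff)

lemma finite_Delta: "finite (Delta k l)"
  by (rule finite_subset[OF _ finite_PiE[of "{..k}" "\<lambda>_. {..l}"]]) (auto simp: Delta_def)

lemma simplicial_homI:
  assumes "\<And>k. k \<in> D \<Longrightarrow> f k \<in> hom (grp X k) (grp Y k)"
    and "\<And>k. k \<in> D \<Longrightarrow> f k \<in> extensional (carrier (grp X k))"
    and "\<And>k. k \<notin> D \<Longrightarrow> f k = undefined"
    and "\<And>k l \<theta> x. k \<in> D \<Longrightarrow> l \<in> D \<Longrightarrow> \<theta> \<in> Delta k l \<Longrightarrow> x \<in> carrier (grp X l) \<Longrightarrow>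
           f k (act X k l \<theta> x) = act Y k l \<theta> (f l x)"
  shows "f \<in> simplicial_hom D X Y"
  using assms by (auto simp: simplicial_hom_def)

lemma simplicial_homD:
  assumes "f \<in> simplicial_hom D X Y"
  shows "\<And>k. k \<in> D \<Longrightarrow> f k \<in> hom (grp X k) (grp Y k)"
    and "\<And>k x. k \<in> D \<Longrightarrow> x \<in> carrier (grp X k) \<Longrightarrow> f k x \<in> carrier (grp Y k)"
    and "\<And>k. k \<in> D \<Longrightarrow> f k \<in> extensional (carrier (grp X k))"
    and "\<And>k. k \<notin> D \<Longrightarrow> f k = undefined"
    and "\<And>k l \<theta> x. k \<in> D \<Longrightarrow> l \<in> D \<Longrightarrow> \<theta> \<in> Delta k l \<Longrightarrow> x \<in> carrier (grp X l) \<Longrightarrow>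
           f k (act X k l \<theta> x) = act Y k l \<theta> (f l x)"
  using assms by (auto simp: simplicial_hom_def PiE_def Pi_def hom_def extensional_def)

lemma simplicial_hom_eqI:
  assumes "f \<in> simplicial_hom D X Y" "g \<in> simplicial_hom D X Y'"
    and "\<And>k x. k \<in> D \<Longrightarrow> x \<in> carrier (grp X k) \<Longrightarrow> f k x = g k x"
  shows "f = g"
proof
  fix k show "f k = g k"
  proof (cases "k \<in> D")
    case True
    show ?thesis
      by (rule extensionalityI[OF simplicial_homD(3)[OF assms(1) True]
            simplicial_homD(3)[OF assms(2) True]]) (rule assms(3)[OF True])
  next
    case False
    then show ?thesis using simplicial_homD(4)[OF assms(1)] simplicial_homD(4)[OF assms(2)] by simp
  qed
qed

lemma simplicial_groupD:
  assumes "simplicial_group_on D X"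
  shows "\<And>k. k \<in> D \<Longrightarrow> group (grp X k)"
    and "\<And>k l \<theta>. k \<in> D \<Longrightarrow> l \<in> D \<Longrightarrow> \<theta> \<in> Delta k l \<Longrightarrow> act X k l \<theta> \<in> hom (grp X l) (grp X k)"
    and "\<And>k l \<theta> x. k \<in> D \<Longrightarrow> l \<in> D \<Longrightarrow> \<theta> \<in> Delta k l \<Longrightarrow> x \<in> carrier (grp X l) \<Longrightarrow>
           act X k l \<theta> x \<in> carrier (grp X k)"
    and "\<And>k x. k \<in> D \<Longrightarrow> x \<in> carrier (grp X k) \<Longrightarrow> act X k k (\<lambda>j\<in>{..k}. j) x = x"
    and "\<And>j k l \<theta> \<phi> x. j \<in> D \<Longrightarrow> k \<in> D \<Longrightarrow> l \<in> D \<Longrightarrow> \<theta> \<in> Delta j k \<Longrightarrow> \<phi> \<in> Delta k l \<Longrightarrow>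
           x \<in> carrier (grp X l) \<Longrightarrow> act X j l (compose {..j} \<phi> \<theta>) x = act X j k \<theta> (act X k l \<phi> x)"
  using assms by (auto simp: simplicial_group_on_def hom_def Pi_def)

lemma SimpGrp_simps:
  "Ob (SimpGrp_on D) = {X. simplicial_group_on D X}"
  "Hom (SimpGrp_on D) = simplicial_hom D"
  "Ident (SimpGrp_on D) X = (\<lambda>k\<in>D. \<lambda>x\<in>carrier (grp X k). x)"
  "Comp (SimpGrp_on D) X Y Z g f = (\<lambda>k\<in>D. compose (carrier (grp X k)) (g k) (f k))"
  by (simp_all add: SimpGrp_on_def)

lemma simplicial_Ident:
  assumes "simplicial_group_on D X"
  shows "(\<lambda>k\<in>D. \<lambda>x\<in>carrier (grp X k). x) \<in> simplicial_hom D X X"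
proof (rule simplicial_homI)
  fix k assume "k \<in> D"
  then interpret group "grp X k" using simplicial_groupD(1)[OF assms] by simp
  show "(\<lambda>k\<in>D. \<lambda>x\<in>carrier (grp X k). x) k \<in> hom (grp X k) (grp X k)"
    using \<open>k \<in> D\<close> by (auto simp: hom_def)
qed (use simplicial_groupD(3)[OF assms] in auto)

lemma simplicial_Comp:
  assumes X: "simplicial_group_on D X" and f: "f \<in> simplicial_hom D X Y" and g: "g \<in> simplicial_hom D Y Z"
  shows "(\<lambda>k\<in>D. compose (carrier (grp X k)) (g k) (f k)) \<in> simplicial_hom D X Z"
proof (rule simplicial_homI)
  fix k assume "k \<in> D"
  then interpret group "grp X k" using simplicial_groupD(1)[OF X] by simp
  show "(\<lambda>k\<in>D. compose (carrier (grp X k)) (g k) (f k)) k \<in> hom (grp X k) (grp Z k)"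
    using \<open>k \<in> D\<close> simplicial_homD(1)[OF f \<open>k \<in> D\<close>] simplicial_homD(1)[OF g \<open>k \<in> D\<close>]
    by (auto simp: hom_def compose_def Pi_def)
qed (use simplicial_groupD(3)[OF X] simplicial_homD(2,5)[OF f] simplicial_homD(2,5)[OF g]
      in \<open>auto simp: compose_def\<close>)

lemma SimpGrp_category: "is_category (SimpGrp_on D)"
  unfolding is_category_def SimpGrp_simps mem_Collect_eq
proof (intro conjI ballI)
  fix X Y f assume X: "X \<in> {X. simplicial_group_on D X}" and Y: "Y \<in> {X. simplicial_group_on D X}"
    and f: "f \<in> simplicial_hom D X Y"
  have X': "simplicial_group_on D X" and Y': "simplicial_group_on D Y" using X Y by auto
  show "(\<lambda>k\<in>D. compose (carrier (grp X k)) ((\<lambda>k\<in>D. \<lambda>x\<in>carrier (grp Y k). x) k) (f k)) = f"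
    by (rule simplicial_hom_eqI[OF simplicial_Comp[OF X' f simplicial_Ident[OF Y']] f])
      (auto simp: compose_def simplicial_homD(2)[OF f])
  show "(\<lambda>k\<in>D. compose (carrier (grp X k)) (f k) ((\<lambda>k\<in>D. \<lambda>x\<in>carrier (grp X k). x) k)) = f"
    by (rule simplicial_hom_eqI[OF simplicial_Comp[OF X' simplicial_Ident[OF X'] f] f])
      (auto simp: compose_def)
next
  fix W X Y Z f g h
  assume "W \<in> {X. simplicial_group_on D X}" "X \<in> {X. simplicial_group_on D X}"
    "Y \<in> {X. simplicial_group_on D X}" "Z \<in> {X. simplicial_group_on D X}"
    and f: "f \<in> simplicial_hom D W X" and g: "g \<in> simplicial_hom D X Y" and h: "h \<in> simplicial_hom D Y Z"
  then have W: "simplicial_group_on D W" and X: "simplicial_group_on D X" by auto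
  show "(\<lambda>k\<in>D. compose (carrier (grp W k)) (h k)
            ((\<lambda>k\<in>D. compose (carrier (grp W k)) (g k) (f k)) k)) =
        (\<lambda>k\<in>D. compose (carrier (grp W k))
            ((\<lambda>k\<in>D. compose (carrier (grp X k)) (h k) (g k)) k) (f k))"
    by (rule simplicial_hom_eqI[OF simplicial_Comp[OF W simplicial_Comp[OF W f g] h]
            simplicial_Comp[OF W f simplicial_Comp[OF X g h]]])
      (auto simp: compose_def simplicial_homD(2)[OF f])
qed (auto intro: simplicial_Ident simplicial_Comp)

lemma tr_simps:
  "k \<le> n \<Longrightarrow> grp (on_ob (tr n) X) k = grp X k"
  "k \<le> n \<Longrightarrow> l \<le> n \<Longrightarrow> act (on_ob (tr n) X) k l = act X k l"
  "k \<le> n \<Longrightarrow> on_hom (tr n) X Y f k = f k"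
  by (simp_all add: tr_def)

lemma tr_Ob: "simplicial_group_on UNIV X \<Longrightarrow> simplicial_group_on {..n} (on_ob (tr n) X)"
  unfolding simplicial_group_on_def by (auto simp: tr_simps)

lemma tr_Hom:
  "f \<in> simplicial_hom UNIV X Y \<Longrightarrow>
     on_hom (tr n) X Y f \<in> simplicial_hom {..n} (on_ob (tr n) X) (on_ob (tr n) Y)"
  by (rule simplicial_homI) (auto simp: tr_simps simplicial_homD tr_def)

lemma tr_functor: "is_functor SimpGrp (TrSimpGrp n) (tr n)"
  unfolding is_functor_def SimpGrp_simps
  using SimpGrp_category tr_Ob tr_Hom by (auto simp: tr_def fun_eq_iff restrict_def)

lemma inj_on_PiE_exists:
  assumes inf: "infinite (UNIV :: 'a set)" and "finite I"
  shows "\<exists>e :: ('i \<Rightarrow> 'a) \<Rightarrow> 'a. inj_on e (PiE I (\<lambda>_. UNIV))"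
  using \<open>finite I\<close>
proof (induction I)
  case empty
  show ?case by auto
next
  case (insert i I)
  then obtain e :: "('i \<Rightarrow> 'a) \<Rightarrow> 'a" where e: "inj_on e (PiE I (\<lambda>_. UNIV))" by blast
  have "(card_of (UNIV \<times> UNIV :: ('a \<times> 'a) set), card_of (UNIV :: 'a set)) \<in> ordLeq"
    using card_of_Times_same_infinite[OF inf] ordIso_iff_ordLeq by blast
  then obtain p :: "'a \<times> 'a \<Rightarrow> 'a" where p: "inj p"
    using card_of_ordLeq[of "UNIV \<times> UNIV :: ('a \<times> 'a) set" "UNIV :: 'a set"] by auto
  have "inj_on (\<lambda>y. p (y i, e (restrict y I))) (PiE (insert i I) (\<lambda>_. UNIV))"
  proof (rule inj_onI)
    fix y z assume y: "y \<in> PiE (insert i I) (\<lambda>_. UNIV)" and z: "z \<in> PiE (insert i I) (\<lambda>_. UNIV)"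
      and "p (y i, e (restrict y I)) = p (z i, e (restrict z I))"
    then have i: "y i = z i" and "e (restrict y I) = e (restrict z I)"
      using p by (auto dest: injD)
    then have "restrict y I = restrict z I"
      using e by (auto dest: inj_onD)
    then have "y j = z j" if "j \<in> I" for j
      using that by (metis restrict_apply')
    then show "y = z"
      using y z i by (intro PiE_ext) auto
  qed
  then show ?case by blast
qed

definition cosk_index :: "nat \<Rightarrow> nat \<Rightarrow> (nat \<times> (nat \<Rightarrow> nat)) set" where
  "cosk_index n k = (SIGMA i:{..n}. Delta i k)"

definition cosk_families :: "nat \<Rightarrow> 'a simplicial \<Rightarrow> nat \<Rightarrow> (nat \<times> (nat \<Rightarrow> nat) \<Rightarrow> 'a) set" where
  "cosk_families n Y k =
     {y \<in> (\<Pi>\<^sub>E p\<in>cosk_index n k. carrier (grp Y (fst p))).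
        \<forall>i\<le>n. \<forall>j\<le>n. \<forall>\<theta>\<in>Delta i k. \<forall>\<phi>\<in>Delta j i.
          y (j, compose {..j} \<theta> \<phi>) = act Y j i \<phi> (y (i, \<theta>))}"

definition cosk_enc :: "nat \<Rightarrow> nat \<Rightarrow> (nat \<times> (nat \<Rightarrow> nat) \<Rightarrow> 'a) \<Rightarrow> 'a" where
  "cosk_enc n k = (SOME e. inj_on e (PiE (cosk_index n k) (\<lambda>_. UNIV)))"

definition cosk_dec :: "nat \<Rightarrow> nat \<Rightarrow> 'a \<Rightarrow> nat \<times> (nat \<Rightarrow> nat) \<Rightarrow> 'a" where
  "cosk_dec n k = inv_into (PiE (cosk_index n k) (\<lambda>_. UNIV)) (cosk_enc n k)"

definition cosk_ob :: "nat \<Rightarrow> 'a simplicial \<Rightarrow> 'a simplicial" where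
  "cosk_ob n Y =
     \<lparr>grp = (\<lambda>k. \<lparr>carrier = cosk_enc n k ` cosk_families n Y k,
        mult = (\<lambda>u v. cosk_enc n k
          (\<lambda>p\<in>cosk_index n k. cosk_dec n k u p \<otimes>\<^bsub>grp Y (fst p)\<^esub> cosk_dec n k v p)),
        one = cosk_enc n k (\<lambda>p\<in>cosk_index n k. \<one>\<^bsub>grp Y (fst p)\<^esub>)\<rparr>),
      act = (\<lambda>k l \<theta> u. cosk_enc n k
        (\<lambda>p\<in>cosk_index n k. cosk_dec n l u (fst p, compose {..fst p} \<theta> (snd p))))\<rparr>"

definition cosk_functor :: "nat \<Rightarrow>
    ('a simplicial, nat \<Rightarrow> 'a \<Rightarrow> 'a, 'a simplicial, nat \<Rightarrow> 'a \<Rightarrow> 'a) cfunctor" where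
  "cosk_functor n =
     \<lparr>on_ob = cosk_ob n,
      on_hom = (\<lambda>X Y f k. \<lambda>u\<in>carrier (grp (cosk_ob n X) k).
        cosk_enc n k (\<lambda>p\<in>cosk_index n k. f (fst p) (cosk_dec n k u p)))\<rparr>"

definition cosk_unit :: "nat \<Rightarrow> 'a simplicial \<Rightarrow> nat \<Rightarrow> 'a \<Rightarrow> 'a" where
  "cosk_unit n X k = (\<lambda>x\<in>carrier (grp X k).
     cosk_enc n k (\<lambda>p\<in>cosk_index n k. act X (fst p) k (snd p) x))"

lemma cosk_enc_inj:
  assumes "infinite (UNIV :: 'a set)"
  shows "inj_on (cosk_enc n k :: _ \<Rightarrow> 'a) (PiE (cosk_index n k) (\<lambda>_. UNIV))"
  unfolding cosk_enc_def
  by (rule someI_ex[of "\<lambda>e. inj_on e (PiE (cosk_index n k) (\<lambda>_. UNIV))"],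
      rule inj_on_PiE_exists[OF assms])
    (auto simp: cosk_index_def finite_Delta)

lemma cosk_dec_enc:
  assumes "infinite (UNIV :: 'a set)" "y \<in> extensional (cosk_index n k)"
  shows "cosk_dec n k (cosk_enc n k y :: 'a) = y"
  unfolding cosk_dec_def
  by (rule inv_into_f_f[OF cosk_enc_inj[OF assms(1)]]) (use assms(2) in \<open>auto simp: PiE_def\<close>)

lemma cosk_familiesD:
  assumes "y \<in> cosk_families n Y k"
  shows "y \<in> extensional (cosk_index n k)"
    and "\<And>i \<theta>. i \<le> n \<Longrightarrow> \<theta> \<in> Delta i k \<Longrightarrow> y (i, \<theta>) \<in> carrier (grp Y i)"
    and "\<And>i j \<theta> \<phi>. i \<le> n \<Longrightarrow> j \<le> n \<Longrightarrow> \<theta> \<in> Delta i k \<Longrightarrow> \<phi> \<in> Delta j i \<Longrightarrow>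
           y (j, compose {..j} \<theta> \<phi>) = act Y j i \<phi> (y (i, \<theta>))"
  using assms by (force simp: cosk_families_def cosk_index_def PiE_def Pi_def)+

lemma cosk_familiesI:
  assumes "\<And>i \<theta>. i \<le> n \<Longrightarrow> \<theta> \<in> Delta i k \<Longrightarrow> y (i, \<theta>) \<in> carrier (grp Y i)"
    and "\<And>i j \<theta> \<phi>. i \<le> n \<Longrightarrow> j \<le> n \<Longrightarrow> \<theta> \<in> Delta i k \<Longrightarrow> \<phi> \<in> Delta j i \<Longrightarrow>
           y (j, compose {..j} \<theta> \<phi>) = act Y j i \<phi> (y (i, \<theta>))"
  shows "restrict y (cosk_index n k) \<in> cosk_families n Y k"
  using assms by (auto simp: cosk_families_def cosk_index_def Delta_compose)

context
  fixes n :: nat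
  assumes inf: "infinite (UNIV :: 'a set)"
begin

lemma cosk_carrier:
  "u \<in> carrier (grp (cosk_ob n Y) k) \<longleftrightarrow>
     cosk_dec n k u \<in> cosk_families n Y k \<and> (u :: 'a) = cosk_enc n k (cosk_dec n k u)"
proof -
  have "\<And>y. y \<in> cosk_families n Y k \<Longrightarrow> cosk_dec n k (cosk_enc n k y :: 'a) = y"
    by (rule cosk_dec_enc[OF inf cosk_familiesD(1)])
  then show ?thesis by (auto simp: cosk_ob_def image_iff)
qed

lemma cosk_enc_carrier:
  "y \<in> cosk_families n Y k \<Longrightarrow> (cosk_enc n k y :: 'a) \<in> carrier (grp (cosk_ob n Y) k)"
  by (simp add: cosk_ob_def)

lemma cosk_dec_restrict [simp]:
  "cosk_dec n k (cosk_enc n k (restrict y (cosk_index n k)) :: 'a) = restrict y (cosk_index n k)"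
  by (rule cosk_dec_enc[OF inf]) auto

lemma cosk_eqI:
  assumes "u \<in> carrier (grp (cosk_ob n Y) k)" "(v :: 'a) \<in> carrier (grp (cosk_ob n Y) k)"
    and "\<And>i \<theta>. i \<le> n \<Longrightarrow> \<theta> \<in> Delta i k \<Longrightarrow> cosk_dec n k u (i, \<theta>) = cosk_dec n k v (i, \<theta>)"
  shows "u = v"
proof -
  have "cosk_dec n k u = cosk_dec n k v"
    using assms cosk_familiesD(1)[of _ n Y k]
    by (intro extensionalityI[where A = "cosk_index n k"])
      (auto simp: cosk_carrier cosk_index_def)
  then show ?thesis using assms by (metis cosk_carrier)
qed

lemmas cosk_decD = cosk_familiesD(2,3)[OF cosk_carrier[THEN iffD1, THEN conjunct1]]

lemma cosk_index_iff [simp]: "(i, \<theta>) \<in> cosk_index n k \<longleftrightarrow> i \<le> n \<and> \<theta> \<in> Delta i k"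
  by (simp add: cosk_index_def)

lemma cosk_mult:
  assumes Y: "simplicial_group_on {..n} (Y :: 'a simplicial)"
    and u: "u \<in> carrier (grp (cosk_ob n Y) k)" and v: "v \<in> carrier (grp (cosk_ob n Y) k)"
  shows "u \<otimes>\<^bsub>grp (cosk_ob n Y) k\<^esub> v \<in> carrier (grp (cosk_ob n Y) k)"
    and "\<And>i \<theta>. i \<le> n \<Longrightarrow> \<theta> \<in> Delta i k \<Longrightarrow>
          cosk_dec n k (u \<otimes>\<^bsub>grp (cosk_ob n Y) k\<^esub> v) (i, \<theta>) =
          cosk_dec n k u (i, \<theta>) \<otimes>\<^bsub>grp Y i\<^esub> cosk_dec n k v (i, \<theta>)"
proof -
  have eq: "u \<otimes>\<^bsub>grp (cosk_ob n Y) k\<^esub> v = cosk_enc n k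
      (\<lambda>p\<in>cosk_index n k. cosk_dec n k u p \<otimes>\<^bsub>grp Y (fst p)\<^esub> cosk_dec n k v p)"
    by (simp add: cosk_ob_def)
  show "u \<otimes>\<^bsub>grp (cosk_ob n Y) k\<^esub> v \<in> carrier (grp (cosk_ob n Y) k)"
    unfolding eq
  proof (intro cosk_enc_carrier cosk_familiesI)
    fix i \<theta> assume i: "i \<le> n" "\<theta> \<in> Delta i k"
    then interpret group "grp Y i" using simplicial_groupD(1)[OF Y] by simp
    show "cosk_dec n k u (i, \<theta>) \<otimes>\<^bsub>grp Y (fst (i, \<theta>))\<^esub> cosk_dec n k v (i, \<theta>) \<in> carrier (grp Y i)"
      using i cosk_decD(1)[OF u] cosk_decD(1)[OF v] by simp
  next
    fix i j \<theta> \<phi> assume i: "i \<le> n" "j \<le> n" "\<theta> \<in> Delta i k" "\<phi> \<in> Delta j i"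
    have "act Y j i \<phi> \<in> hom (grp Y i) (grp Y j)"
      using simplicial_groupD(2)[OF Y] i by simp
    then show "cosk_dec n k u (j, compose {..j} \<theta> \<phi>) \<otimes>\<^bsub>grp Y (fst (j, compose {..j} \<theta> \<phi>))\<^esub>
          cosk_dec n k v (j, compose {..j} \<theta> \<phi>) =
        act Y j i \<phi> (cosk_dec n k u (i, \<theta>) \<otimes>\<^bsub>grp Y (fst (i, \<theta>))\<^esub> cosk_dec n k v (i, \<theta>))"
      using i cosk_decD[OF u] cosk_decD[OF v] by (simp add: hom_mult)
  qed
  show "cosk_dec n k (u \<otimes>\<^bsub>grp (cosk_ob n Y) k\<^esub> v) (i, \<theta>) =
          cosk_dec n k u (i, \<theta>) \<otimes>\<^bsub>grp Y i\<^esub> cosk_dec n k v (i, \<theta>)"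
    if "i \<le> n" "\<theta> \<in> Delta i k" for i \<theta>
    unfolding eq using that by simp
qed

lemma cosk_one:
  assumes Y: "simplicial_group_on {..n} (Y :: 'a simplicial)"
  shows "\<one>\<^bsub>grp (cosk_ob n Y) k\<^esub> \<in> carrier (grp (cosk_ob n Y) k)"
    and "\<And>i \<theta>. i \<le> n \<Longrightarrow> \<theta> \<in> Delta i k \<Longrightarrow>
          cosk_dec n k \<one>\<^bsub>grp (cosk_ob n Y) k\<^esub> (i, \<theta>) = \<one>\<^bsub>grp Y i\<^esub>"
proof -
  have eq: "\<one>\<^bsub>grp (cosk_ob n Y) k\<^esub> = cosk_enc n k (\<lambda>p\<in>cosk_index n k. \<one>\<^bsub>grp Y (fst p)\<^esub>)"
    by (simp add: cosk_ob_def)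
  show "\<one>\<^bsub>grp (cosk_ob n Y) k\<^esub> \<in> carrier (grp (cosk_ob n Y) k)"
    unfolding eq
  proof (intro cosk_enc_carrier cosk_familiesI)
    fix i assume "i \<le> n"
    then interpret group "grp Y i" using simplicial_groupD(1)[OF Y] by simp
    fix \<theta> show "\<one>\<^bsub>grp Y (fst (i, \<theta>))\<^esub> \<in> carrier (grp Y i)" for \<theta> :: "nat \<Rightarrow> nat" by simp
  next
    fix i j \<theta> \<phi> assume i: "i \<le> n" "j \<le> n" "\<theta> \<in> Delta i k" "\<phi> \<in> Delta j i"
    have "act Y j i \<phi> \<in> hom (grp Y i) (grp Y j)"
      using simplicial_groupD(2)[OF Y] i by simp
    then show "\<one>\<^bsub>grp Y (fst (j, compose {..j} \<theta> \<phi>))\<^esub> = act Y j i \<phi> \<one>\<^bsub>grp Y (fst (i, \<theta>))\<^esub>"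
      using simplicial_groupD(1)[OF Y] i by (simp add: hom_one)
  qed
  show "cosk_dec n k \<one>\<^bsub>grp (cosk_ob n Y) k\<^esub> (i, \<theta>) = \<one>\<^bsub>grp Y i\<^esub>"
    if "i \<le> n" "\<theta> \<in> Delta i k" for i \<theta>
    unfolding eq using that by simp
qed

lemma cosk_hom_eqI:
  assumes "f \<in> simplicial_hom UNIV X (cosk_ob n Y)" "g \<in> simplicial_hom UNIV X (cosk_ob n (Y :: 'a simplicial))"
    and "\<And>k x i \<theta>. x \<in> carrier (grp X k) \<Longrightarrow> i \<le> n \<Longrightarrow> \<theta> \<in> Delta i k \<Longrightarrow>
           cosk_dec n k (f k x) (i, \<theta>) = cosk_dec n k (g k x) (i, \<theta>)"
  shows "f = g"
  by (rule simplicial_hom_eqI[OF assms(1,2)])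
    (rule cosk_eqI, auto intro: simplicial_homD(2)[OF assms(1)] simplicial_homD(2)[OF assms(2)] assms(3))

lemma cosk_group:
  assumes Y: "simplicial_group_on {..n} (Y :: 'a simplicial)"
  shows "group (grp (cosk_ob n Y) k)"
proof (rule groupI)
  note G = simplicial_groupD(1)[OF Y]
  fix u v w assume u: "u \<in> carrier (grp (cosk_ob n Y) k)" and v: "v \<in> carrier (grp (cosk_ob n Y) k)"
    and w: "w \<in> carrier (grp (cosk_ob n Y) k)"
  show "u \<otimes>\<^bsub>grp (cosk_ob n Y) k\<^esub> v \<otimes>\<^bsub>grp (cosk_ob n Y) k\<^esub> w =
        u \<otimes>\<^bsub>grp (cosk_ob n Y) k\<^esub> (v \<otimes>\<^bsub>grp (cosk_ob n Y) k\<^esub> w)"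
  proof (rule cosk_eqI[where Y = Y and k = k])
    fix i \<theta> assume i: "i \<le> n" "\<theta> \<in> Delta i k"
    then interpret group "grp Y i" using G by simp
    show "cosk_dec n k (u \<otimes>\<^bsub>grp (cosk_ob n Y) k\<^esub> v \<otimes>\<^bsub>grp (cosk_ob n Y) k\<^esub> w) (i, \<theta>) =
        cosk_dec n k (u \<otimes>\<^bsub>grp (cosk_ob n Y) k\<^esub> (v \<otimes>\<^bsub>grp (cosk_ob n Y) k\<^esub> w)) (i, \<theta>)"
      using cosk_decD(1)[OF u i] cosk_decD(1)[OF v i] cosk_decD(1)[OF w i]
      by (simp add: cosk_mult[OF Y] u v w i m_assoc)
  qed (simp_all add: cosk_mult[OF Y] u v w)
next
  note G = simplicial_groupD(1)[OF Y]
  fix u assume u: "u \<in> carrier (grp (cosk_ob n Y) k)"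
  show "\<one>\<^bsub>grp (cosk_ob n Y) k\<^esub> \<otimes>\<^bsub>grp (cosk_ob n Y) k\<^esub> u = u"
  proof (rule cosk_eqI[where Y = Y and k = k])
    fix i \<theta> assume i: "i \<le> n" "\<theta> \<in> Delta i k"
    then interpret group "grp Y i" using G by simp
    show "cosk_dec n k (\<one>\<^bsub>grp (cosk_ob n Y) k\<^esub> \<otimes>\<^bsub>grp (cosk_ob n Y) k\<^esub> u) (i, \<theta>) =
        cosk_dec n k u (i, \<theta>)"
      using cosk_decD(1)[OF u i] by (simp add: cosk_mult[OF Y] cosk_one[OF Y] u i)
  qed (simp_all add: cosk_mult[OF Y] cosk_one[OF Y] u)
  define y where "y = (\<lambda>p. inv\<^bsub>grp Y (fst p)\<^esub> (cosk_dec n k u p))"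
  define v where "v = cosk_enc n k (restrict y (cosk_index n k))"
  have v: "v \<in> carrier (grp (cosk_ob n Y) k)"
    unfolding v_def
  proof (intro cosk_enc_carrier cosk_familiesI)
    fix i \<theta> assume "i \<le> n" "\<theta> \<in> Delta i k"
    then show "y (i, \<theta>) \<in> carrier (grp Y i)"
      using G cosk_decD(1)[OF u] by (simp add: y_def)
  next
    fix i j \<theta> \<phi> assume i: "i \<le> n" "j \<le> n" "\<theta> \<in> Delta i k" "\<phi> \<in> Delta j i"
    then interpret group_hom "grp Y i" "grp Y j" "act Y j i \<phi>"
      using G simplicial_groupD(2)[OF Y] by (simp add: group_hom_def group_hom_axioms_def)
    show "y (j, compose {..j} \<theta> \<phi>) = act Y j i \<phi> (y (i, \<theta>))"
      using i cosk_decD[OF u] by (simp add: y_def)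
  qed
  have dv: "cosk_dec n k v (i, \<theta>) = inv\<^bsub>grp Y i\<^esub> (cosk_dec n k u (i, \<theta>))"
    if "i \<le> n" "\<theta> \<in> Delta i k" for i \<theta>
    unfolding v_def using that by (simp add: y_def)
  have "v \<otimes>\<^bsub>grp (cosk_ob n Y) k\<^esub> u = \<one>\<^bsub>grp (cosk_ob n Y) k\<^esub>"
  proof (rule cosk_eqI[where Y = Y and k = k])
    fix i \<theta> assume i: "i \<le> n" "\<theta> \<in> Delta i k"
    then interpret group "grp Y i" using G by simp
    show "cosk_dec n k (v \<otimes>\<^bsub>grp (cosk_ob n Y) k\<^esub> u) (i, \<theta>) =
        cosk_dec n k \<one>\<^bsub>grp (cosk_ob n Y) k\<^esub> (i, \<theta>)"
      using cosk_decD(1)[OF u i] by (simp add: cosk_mult[OF Y] cosk_one[OF Y] u v dv i)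
  qed (simp_all add: cosk_mult[OF Y] cosk_one[OF Y] u v)
  then show "\<exists>v\<in>carrier (grp (cosk_ob n Y) k).
      v \<otimes>\<^bsub>grp (cosk_ob n Y) k\<^esub> u = \<one>\<^bsub>grp (cosk_ob n Y) k\<^esub>"
    using v by blast
qed (auto simp: cosk_mult[OF Y] cosk_one[OF Y])

lemma cosk_act:
  assumes u: "(u :: 'a) \<in> carrier (grp (cosk_ob n Y) l)" and \<theta>: "\<theta> \<in> Delta k l"
  shows "act (cosk_ob n Y) k l \<theta> u \<in> carrier (grp (cosk_ob n Y) k)"
    and "\<And>i \<phi>. i \<le> n \<Longrightarrow> \<phi> \<in> Delta i k \<Longrightarrow>
          cosk_dec n k (act (cosk_ob n Y) k l \<theta> u) (i, \<phi>) = cosk_dec n l u (i, compose {..i} \<theta> \<phi>)"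
proof -
  have eq: "act (cosk_ob n Y) k l \<theta> u = cosk_enc n k
      (\<lambda>p\<in>cosk_index n k. cosk_dec n l u (fst p, compose {..fst p} \<theta> (snd p)))"
    by (simp add: cosk_ob_def)
  show "act (cosk_ob n Y) k l \<theta> u \<in> carrier (grp (cosk_ob n Y) k)"
    unfolding eq
  proof (intro cosk_enc_carrier cosk_familiesI)
    fix i \<phi> assume "i \<le> n" "\<phi> \<in> Delta i k"
    then show "cosk_dec n l u (fst (i, \<phi>), compose {..fst (i, \<phi>)} \<theta> (snd (i, \<phi>))) \<in> carrier (grp Y i)"
      using cosk_decD(1)[OF u] Delta_compose[OF _ \<theta>] by simp
  next
    fix i j \<phi> \<psi> assume i: "i \<le> n" "j \<le> n" "\<phi> \<in> Delta i k" "\<psi> \<in> Delta j i"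
    then show "cosk_dec n l u (fst (j, compose {..j} \<phi> \<psi>),
          compose {..fst (j, compose {..j} \<phi> \<psi>)} \<theta> (snd (j, compose {..j} \<phi> \<psi>))) =
        act Y j i \<psi> (cosk_dec n l u (fst (i, \<phi>), compose {..fst (i, \<phi>)} \<theta> (snd (i, \<phi>))))"
      using cosk_decD(2)[OF u, of i j "compose {..i} \<theta> \<phi>" \<psi>] Delta_compose[OF _ \<theta>]
      by (simp add: Delta_assoc)
  qed
  show "cosk_dec n k (act (cosk_ob n Y) k l \<theta> u) (i, \<phi>) = cosk_dec n l u (i, compose {..i} \<theta> \<phi>)"
    if "i \<le> n" "\<phi> \<in> Delta i k" for i \<phi>
    unfolding eq using that by simp
qed

lemma cosk_Ob:
  assumes Y: "simplicial_group_on {..n} (Y :: 'a simplicial)"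
  shows "simplicial_group_on UNIV (cosk_ob n Y)"
  unfolding simplicial_group_on_def
proof (intro conjI ballI)
  fix k l \<theta> assume \<theta>: "\<theta> \<in> Delta k l"
  have "act (cosk_ob n Y) k l \<theta> (u \<otimes>\<^bsub>grp (cosk_ob n Y) l\<^esub> v) =
      act (cosk_ob n Y) k l \<theta> u \<otimes>\<^bsub>grp (cosk_ob n Y) k\<^esub> act (cosk_ob n Y) k l \<theta> v"
    if u: "u \<in> carrier (grp (cosk_ob n Y) l)" and v: "v \<in> carrier (grp (cosk_ob n Y) l)" for u v
    by (rule cosk_eqI[where Y = Y and k = k])
      (auto simp: cosk_mult[OF Y] cosk_act[OF _ \<theta>] u v Delta_compose[OF _ \<theta>])
  then show "act (cosk_ob n Y) k l \<theta> \<in> hom (grp (cosk_ob n Y) l) (grp (cosk_ob n Y) k)"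
    by (auto simp: hom_def cosk_act[OF _ \<theta>])
next
  fix k u assume u: "u \<in> carrier (grp (cosk_ob n Y) k)"
  show "act (cosk_ob n Y) k k (\<lambda>j\<in>{..k}. j) u = u"
    by (rule cosk_eqI[where Y = Y and k = k]) (simp_all only: cosk_act[OF u Delta_id] u Delta_id_compose)
next
  fix j k l \<theta> \<phi> u assume \<theta>: "\<theta> \<in> Delta j k" and \<phi>: "\<phi> \<in> Delta k l"
    and u: "u \<in> carrier (grp (cosk_ob n Y) l)"
  show "act (cosk_ob n Y) j l (compose {..j} \<phi> \<theta>) u =
        act (cosk_ob n Y) j k \<theta> (act (cosk_ob n Y) k l \<phi> u)"
    by (rule cosk_eqI[where Y = Y and k = j])
      (auto simp: cosk_act[OF u Delta_compose[OF \<theta> \<phi>]] cosk_act[OF cosk_act(1)[OF u \<phi>] \<theta>]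
        cosk_act[OF u \<phi>] Delta_compose[OF _ \<theta>] Delta_assoc)
qed (rule cosk_group[OF Y])

lemma cosk_on_hom:
  assumes f: "f \<in> simplicial_hom {..n} X Y" and u: "(u :: 'a) \<in> carrier (grp (cosk_ob n X) k)"
  shows "on_hom (cosk_functor n) X Y f k u \<in> carrier (grp (cosk_ob n Y) k)"
    and "\<And>i \<theta>. i \<le> n \<Longrightarrow> \<theta> \<in> Delta i k \<Longrightarrow>
          cosk_dec n k (on_hom (cosk_functor n) X Y f k u) (i, \<theta>) = f i (cosk_dec n k u (i, \<theta>))"
proof -
  have eq: "on_hom (cosk_functor n) X Y f k u =
      cosk_enc n k (\<lambda>p\<in>cosk_index n k. f (fst p) (cosk_dec n k u p))"
    using u by (simp add: cosk_functor_def)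
  show "on_hom (cosk_functor n) X Y f k u \<in> carrier (grp (cosk_ob n Y) k)"
    unfolding eq
    by (intro cosk_enc_carrier cosk_familiesI)
      (simp_all add: cosk_decD[OF u] simplicial_homD(2,5)[OF f])
  show "cosk_dec n k (on_hom (cosk_functor n) X Y f k u) (i, \<theta>) = f i (cosk_dec n k u (i, \<theta>))"
    if "i \<le> n" "\<theta> \<in> Delta i k" for i \<theta>
    unfolding eq using that by simp
qed

lemma cosk_Hom:
  assumes X: "simplicial_group_on {..n} X" and Y: "simplicial_group_on {..n} (Y :: 'a simplicial)"
    and f: "f \<in> simplicial_hom {..n} X Y"
  shows "on_hom (cosk_functor n) X Y f \<in> simplicial_hom UNIV (cosk_ob n X) (cosk_ob n Y)"
proof (rule simplicial_homI)
  fix k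
  have "on_hom (cosk_functor n) X Y f k (u \<otimes>\<^bsub>grp (cosk_ob n X) k\<^esub> v) =
      on_hom (cosk_functor n) X Y f k u \<otimes>\<^bsub>grp (cosk_ob n Y) k\<^esub> on_hom (cosk_functor n) X Y f k v"
    if u: "u \<in> carrier (grp (cosk_ob n X) k)" and v: "v \<in> carrier (grp (cosk_ob n X) k)" for u v
  proof (rule cosk_eqI[where Y = Y and k = k])
    fix i \<theta> assume i: "i \<le> n" "\<theta> \<in> Delta i k"
    have "f i \<in> hom (grp X i) (grp Y i)" using simplicial_homD(1)[OF f] i by simp
    then show "cosk_dec n k (on_hom (cosk_functor n) X Y f k (u \<otimes>\<^bsub>grp (cosk_ob n X) k\<^esub> v)) (i, \<theta>) =
      cosk_dec n k (on_hom (cosk_functor n) X Y f k u \<otimes>\<^bsub>grp (cosk_ob n Y) k\<^esub>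
        on_hom (cosk_functor n) X Y f k v) (i, \<theta>)"
      using i u v cosk_decD(1)[OF u i] cosk_decD(1)[OF v i]
      by (simp add: cosk_on_hom[OF f] cosk_mult[OF X] cosk_mult[OF Y] hom_mult)
  qed (use u v in \<open>auto simp: cosk_on_hom[OF f] cosk_mult[OF X] cosk_mult[OF Y]\<close>)
  then show "on_hom (cosk_functor n) X Y f k \<in> hom (grp (cosk_ob n X) k) (grp (cosk_ob n Y) k)"
    by (auto simp: hom_def cosk_on_hom[OF f])
next
  fix k l \<theta> u assume \<theta>: "\<theta> \<in> Delta k l" and u: "u \<in> carrier (grp (cosk_ob n X) l)"
  show "on_hom (cosk_functor n) X Y f k (act (cosk_ob n X) k l \<theta> u) =
        act (cosk_ob n Y) k l \<theta> (on_hom (cosk_functor n) X Y f l u)"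
    by (rule cosk_eqI[where Y = Y and k = k])
      (auto simp: cosk_act[OF u \<theta>] cosk_act[OF cosk_on_hom(1)[OF f u] \<theta>] cosk_on_hom[OF f]
        cosk_on_hom[OF f u] Delta_compose[OF _ \<theta>])
qed (auto simp: cosk_functor_def)

lemma cosk_is_functor: "is_functor (TrSimpGrp n) (SimpGrp :: ('a simplicial, _) cat) (cosk_functor n)"
proof -
  have ob: "on_ob (cosk_functor n) = (cosk_ob n :: 'a simplicial \<Rightarrow> _)"
    by (simp add: cosk_functor_def)
  show ?thesis
    unfolding is_functor_def SimpGrp_simps ob
  proof (intro conjI ballI SimpGrp_category)
    fix X :: "'a simplicial" assume "X \<in> {X. simplicial_group_on {..n} X}"
    then have X: "simplicial_group_on {..n} X" by simp
    show "on_hom (cosk_functor n) X X (\<lambda>k\<in>{..n}. \<lambda>x\<in>carrier (grp X k). x) =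
        (\<lambda>k\<in>UNIV. \<lambda>x\<in>carrier (grp (cosk_ob n X) k). x)"
      by (rule cosk_hom_eqI[OF cosk_Hom[OF X X simplicial_Ident[OF X]]
            simplicial_Ident[OF cosk_Ob[OF X]]])
        (auto simp: cosk_on_hom[OF simplicial_Ident[OF X]] cosk_decD)
  next
    fix X Y Z :: "'a simplicial" and f g
    assume "X \<in> {X. simplicial_group_on {..n} X}" "Y \<in> {X. simplicial_group_on {..n} X}"
      "Z \<in> {X. simplicial_group_on {..n} X}"
      and f: "f \<in> simplicial_hom {..n} X Y" and g: "g \<in> simplicial_hom {..n} Y Z"
    then have X: "simplicial_group_on {..n} X" and Y: "simplicial_group_on {..n} Y"
      and Z: "simplicial_group_on {..n} Z" by auto
    define h where "h = (\<lambda>k\<in>{..n}. compose (carrier (grp X k)) (g k) (f k))"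
    have h: "h \<in> simplicial_hom {..n} X Z" unfolding h_def by (rule simplicial_Comp[OF X f g])
    have hx: "h k x = g k (f k x)" if "k \<le> n" "x \<in> carrier (grp X k)" for k x
      using that by (simp add: h_def compose_def)
    have "on_hom (cosk_functor n) X Z h =
      (\<lambda>k\<in>UNIV. compose (carrier (grp (cosk_ob n X) k)) (on_hom (cosk_functor n) Y Z g k)
          (on_hom (cosk_functor n) X Y f k))"
      by (rule cosk_hom_eqI[OF cosk_Hom[OF X Z h]
            simplicial_Comp[OF cosk_Ob[OF X] cosk_Hom[OF X Y f] cosk_Hom[OF Y Z g]]])
        (auto simp: cosk_on_hom[OF h] cosk_on_hom[OF f] cosk_on_hom[OF g] compose_def cosk_decD hx)
    then show "on_hom (cosk_functor n) X Z (\<lambda>k\<in>{..n}. compose (carrier (grp X k)) (g k) (f k)) =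
      (\<lambda>k\<in>UNIV. compose (carrier (grp (cosk_ob n X) k)) (on_hom (cosk_functor n) Y Z g k)
          (on_hom (cosk_functor n) X Y f k))"
      unfolding h_def .
  qed (auto simp: cosk_Ob cosk_Hom)
qed

lemma cosk_unit:
  assumes X: "simplicial_group_on UNIV X" and x: "(x :: 'a) \<in> carrier (grp X k)"
  shows "cosk_unit n X k x \<in> carrier (grp (cosk_ob n (on_ob (tr n) X)) k)"
    and "\<And>i \<theta>. i \<le> n \<Longrightarrow> \<theta> \<in> Delta i k \<Longrightarrow>
          cosk_dec n k (cosk_unit n X k x) (i, \<theta>) = act X i k \<theta> x"
proof -
  have eq: "cosk_unit n X k x = cosk_enc n k (\<lambda>p\<in>cosk_index n k. act X (fst p) k (snd p) x)"
    using x by (simp add: cosk_unit_def)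
  show "cosk_unit n X k x \<in> carrier (grp (cosk_ob n (on_ob (tr n) X)) k)"
    unfolding eq
    by (intro cosk_enc_carrier cosk_familiesI)
      (simp_all add: tr_simps simplicial_groupD(3,5)[OF X] x)
  show "cosk_dec n k (cosk_unit n X k x) (i, \<theta>) = act X i k \<theta> x"
    if "i \<le> n" "\<theta> \<in> Delta i k" for i \<theta>
    unfolding eq using that by simp
qed

lemma cosk_unit_Hom:
  assumes X: "simplicial_group_on UNIV (X :: 'a simplicial)"
  shows "cosk_unit n X \<in> simplicial_hom UNIV X (cosk_ob n (on_ob (tr n) X))"
proof (rule simplicial_homI)
  note tX = tr_Ob[OF X, of n]
  fix k
  interpret group "grp X k" using simplicial_groupD(1)[OF X] by simp
  have "cosk_unit n X k (x \<otimes>\<^bsub>grp X k\<^esub> y) =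
      cosk_unit n X k x \<otimes>\<^bsub>grp (cosk_ob n (on_ob (tr n) X)) k\<^esub> cosk_unit n X k y"
    if x: "x \<in> carrier (grp X k)" and y: "y \<in> carrier (grp X k)" for x y
  proof (rule cosk_eqI[where Y = "on_ob (tr n) X" and k = k])
    fix i \<theta> assume i: "i \<le> n" "\<theta> \<in> Delta i k"
    have "act X i k \<theta> \<in> hom (grp X k) (grp X i)"
      using simplicial_groupD(2)[OF X] i by simp
    then show "cosk_dec n k (cosk_unit n X k (x \<otimes>\<^bsub>grp X k\<^esub> y)) (i, \<theta>) =
        cosk_dec n k (cosk_unit n X k x \<otimes>\<^bsub>grp (cosk_ob n (on_ob (tr n) X)) k\<^esub>
          cosk_unit n X k y) (i, \<theta>)"
      using i x y by (simp add: cosk_unit[OF X] cosk_mult[OF tX] hom_mult tr_simps)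
  qed (use x y in \<open>auto simp: cosk_unit[OF X] cosk_mult[OF tX]\<close>)
  then show "cosk_unit n X k \<in> hom (grp X k) (grp (cosk_ob n (on_ob (tr n) X)) k)"
    by (auto simp: hom_def cosk_unit[OF X])
next
  fix k l \<theta> x assume \<theta>: "\<theta> \<in> Delta k l" and x: "x \<in> carrier (grp X l)"
  have ax: "act X k l \<theta> x \<in> carrier (grp X k)" using simplicial_groupD(3)[OF X _ _ \<theta> x] by simp
  show "cosk_unit n X k (act X k l \<theta> x) = act (cosk_ob n (on_ob (tr n) X)) k l \<theta> (cosk_unit n X l x)"
    by (rule cosk_eqI[where Y = "on_ob (tr n) X" and k = k])
      (auto simp: cosk_unit[OF X ax] cosk_unit[OF X x] cosk_act[OF cosk_unit(1)[OF X x] \<theta>]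
        simplicial_groupD(5)[OF X] \<theta> x Delta_compose[OF _ \<theta>])
qed (auto simp: cosk_unit_def)

theorem cosk_right_adjoint:
  "right_adjoint (SimpGrp :: ('a simplicial, _) cat) (TrSimpGrp n) (tr n) (cosk_functor n) (cosk_unit n)"
proof -
  have ob: "on_ob (cosk_functor n) = (cosk_ob n :: 'a simplicial \<Rightarrow> _)"
    by (simp add: cosk_functor_def)
  have fid: "is_functor (SimpGrp :: ('a simplicial, _) cat) SimpGrp functor_id"
    by (simp add: is_functor_def functor_id_def SimpGrp_category)
  have comp: "is_functor (SimpGrp :: ('a simplicial, _) cat) SimpGrp (functor_comp (cosk_functor n) (tr n))"
    using tr_functor[where 'a = 'a, of n] cosk_is_functor
    by (simp add: is_functor_def functor_comp_def)
  have nat: "nat_trans (SimpGrp :: ('a simplicial, _) cat) SimpGrp functor_id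
      (functor_comp (cosk_functor n) (tr n)) (cosk_unit n)"
    unfolding nat_trans_def
  proof (intro conjI ballI fid comp)
    fix X Y :: "'a simplicial" and f
    assume "X \<in> Ob SimpGrp" "Y \<in> Ob SimpGrp" "f \<in> Hom SimpGrp X Y"
    then have X: "simplicial_group_on UNIV X" and Y: "simplicial_group_on UNIV Y"
      and f: "f \<in> simplicial_hom UNIV X Y" by (simp_all add: SimpGrp_simps)
    note tf = tr_Hom[OF f, of n] and tX = tr_Ob[OF X, of n] and tY = tr_Ob[OF Y, of n]
    have "(\<lambda>k\<in>UNIV. compose (carrier (grp X k)) (cosk_unit n Y k) (f k)) =
       (\<lambda>k\<in>UNIV. compose (carrier (grp X k))
         (on_hom (cosk_functor n) (on_ob (tr n) X) (on_ob (tr n) Y) (on_hom (tr n) X Y f) k)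
         (cosk_unit n X k))"
      by (rule cosk_hom_eqI[OF simplicial_Comp[OF X f cosk_unit_Hom[OF Y]]
            simplicial_Comp[OF X cosk_unit_Hom[OF X] cosk_Hom[OF tX tY tf]]])
        (auto simp: compose_def cosk_unit[OF X] cosk_unit[OF Y] cosk_on_hom[OF tf]
          simplicial_homD(2,5)[OF f] tr_simps)
    then show "Comp SimpGrp (on_ob functor_id X) (on_ob functor_id Y) (on_ob (functor_comp (cosk_functor n) (tr n)) Y)
          (cosk_unit n Y) (on_hom functor_id X Y f) =
        Comp SimpGrp (on_ob functor_id X) (on_ob (functor_comp (cosk_functor n) (tr n)) X)
          (on_ob (functor_comp (cosk_functor n) (tr n)) Y)
          (on_hom (functor_comp (cosk_functor n) (tr n)) X Y f) (cosk_unit n X)"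
      by (simp add: SimpGrp_simps functor_id_def functor_comp_def ob)
  qed (auto simp: SimpGrp_simps functor_id_def functor_comp_def ob cosk_unit_Hom)
  show ?thesis
    unfolding right_adjoint_def
  proof (intro conjI ballI tr_functor cosk_is_functor nat)
    fix X Y :: "'a simplicial" and g
    assume "X \<in> Ob SimpGrp" "Y \<in> Ob (TrSimpGrp n)" "g \<in> Hom SimpGrp X (on_ob (cosk_functor n) Y)"
    then have X: "simplicial_group_on UNIV X" and Y: "simplicial_group_on {..n} Y"
      and g: "g \<in> simplicial_hom UNIV X (cosk_ob n Y)" by (simp_all add: SimpGrp_simps ob)
    note tX = tr_Ob[OF X, of n]
    note gc = simplicial_homD(2)[OF g UNIV_I]
    define f where "f = (\<lambda>i\<in>{..n}. \<lambda>x\<in>carrier (grp X i). cosk_dec n i (g i x) (i, \<lambda>j\<in>{..i}. j))"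
    have fx: "f i x = cosk_dec n i (g i x) (i, \<lambda>j\<in>{..i}. j)"
      if "i \<le> n" "x \<in> carrier (grp X i)" for i x
      using that by (simp add: f_def)
    have key: "cosk_dec n k (g k x) (i, \<theta>) = f i (act X i k \<theta> x)"
      if x: "x \<in> carrier (grp X k)" and i: "i \<le> n" and \<theta>: "\<theta> \<in> Delta i k" for k x i \<theta>
    proof -
      have "f i (act X i k \<theta> x) = cosk_dec n i (g i (act X i k \<theta> x)) (i, \<lambda>j\<in>{..i}. j)"
        using fx i simplicial_groupD(3)[OF X _ _ \<theta> x] by simp
      also have "\<dots> = cosk_dec n i (act (cosk_ob n Y) i k \<theta> (g k x)) (i, \<lambda>j\<in>{..i}. j)"
        using simplicial_homD(5)[OF g _ _ \<theta> x] by simp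
      also have "\<dots> = cosk_dec n k (g k x) (i, \<theta>)"
        using cosk_act(2)[OF gc[OF x] \<theta> i Delta_id] Delta_compose_id[OF \<theta>] by simp
      finally show ?thesis by simp
    qed
    have f: "f \<in> simplicial_hom {..n} (on_ob (tr n) X) Y"
    proof (rule simplicial_homI)
      fix k assume "k \<in> {..n}"
      then have k: "k \<le> n" by simp
      interpret group "grp X k" using simplicial_groupD(1)[OF X] by simp
      have "g k \<in> hom (grp X k) (grp (cosk_ob n Y) k)" using simplicial_homD(1)[OF g] by simp
      then have "f k \<in> hom (grp X k) (grp Y k)"
        using k by (auto simp: hom_def Pi_def fx cosk_mult[OF Y] gc Delta_id cosk_decD(1)[OF gc])
      then show "f k \<in> hom (grp (on_ob (tr n) X) k) (grp Y k)" using k by (simp add: tr_simps)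
    next
      fix k l \<theta> x assume k: "k \<in> {..n}" "l \<in> {..n}" and \<theta>: "\<theta> \<in> Delta k l"
        and "x \<in> carrier (grp (on_ob (tr n) X) l)"
      then have x: "x \<in> carrier (grp X l)" by (simp add: tr_simps)
      have "f k (act X k l \<theta> x) = cosk_dec n l (g l x) (k, \<theta>)"
        using key[OF x _ \<theta>] k by simp
      also have "\<dots> = act Y k l \<theta> (cosk_dec n l (g l x) (l, \<lambda>j\<in>{..l}. j))"
        using cosk_decD(2)[OF gc[OF x], of l k "\<lambda>j\<in>{..l}. j" \<theta>] k \<theta> Delta_id
        by (simp add: Delta_id_compose)
      finally show "f k (act (on_ob (tr n) X) k l \<theta> x) = act Y k l \<theta> (f l x)"
        using k x by (simp add: tr_simps fx)
    qed (auto simp: f_def tr_simps)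
    have eq: "g = (\<lambda>k\<in>UNIV. compose (carrier (grp X k))
        (on_hom (cosk_functor n) (on_ob (tr n) X) Y f k) (cosk_unit n X k))"
      by (rule cosk_hom_eqI[OF g simplicial_Comp[OF X cosk_unit_Hom[OF X] cosk_Hom[OF tX Y f]]])
        (auto simp: compose_def cosk_unit[OF X] cosk_on_hom[OF f] gc key)
    have unique: "f' = f" if f': "f' \<in> simplicial_hom {..n} (on_ob (tr n) X) Y"
      and eq': "g = (\<lambda>k\<in>UNIV. compose (carrier (grp X k))
        (on_hom (cosk_functor n) (on_ob (tr n) X) Y f' k) (cosk_unit n X k))" for f'
    proof (rule simplicial_hom_eqI[OF f' f])
      fix k x assume "k \<in> {..n}" "x \<in> carrier (grp (on_ob (tr n) X) k)"
      then have k: "k \<le> n" and x: "x \<in> carrier (grp X k)" by (simp_all add: tr_simps)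
      have "f k x = cosk_dec n k (g k x) (k, \<lambda>j\<in>{..k}. j)" by (rule fx[OF k x])
      also have "g k x = on_hom (cosk_functor n) (on_ob (tr n) X) Y f' k (cosk_unit n X k x)"
        by (subst eq') (simp add: compose_def x)
      also have "cosk_dec n k \<dots> (k, \<lambda>j\<in>{..k}. j) = f' k (act X k k (\<lambda>j\<in>{..k}. j) x)"
        by (simp only: cosk_on_hom(2)[OF f' cosk_unit(1)[OF X x] k Delta_id]
            cosk_unit(2)[OF X x k Delta_id])
      also have "\<dots> = f' k x" using simplicial_groupD(4)[OF X _ x] by simp
      finally show "f' k x = f k x" by simp
    qed
    show "\<exists>!f. f \<in> Hom (TrSimpGrp n) (on_ob (tr n) X) Y \<and>
        g = Comp SimpGrp X (on_ob (cosk_functor n) (on_ob (tr n) X)) (on_ob (cosk_functor n) Y)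
          (on_hom (cosk_functor n) (on_ob (tr n) X) Y f) (cosk_unit n X)"
      unfolding SimpGrp_simps ob
    proof (rule ex1I[of _ f], intro conjI)
      show "f \<in> simplicial_hom {..n} (on_ob (tr n) X) Y" by (rule f)
    qed (rule eq, elim conjE, rule unique)
  qed
qed

end

end

theory Submission
  imports Defs
begin

text \<open>
  If \<open>X\<close> is trivial below degree \<open>k\<close>, all faces on \<open>X\<^sub>k\<close> vanish and \<open>N(X)\<^sub>k = X\<^sub>k\<close>; so \<open>N(X)\<close>
  vanishes up to degree \<open>n\<close> iff \<open>X\<close> does, and the two subcategories coincide. The unit at \<open>X\<close> is
  monic iff truncation is faithful on maps into \<open>X\<close>, so the torsion theory does not depend on a
  description of the coskeleton: the torsion part of \<open>X\<close> consists of those \<open>x\<close> that are killed by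
  all operators into degrees \<open>\<le> n\<close>, and maps into the quotient by it are determined
  by their truncations.
\<close>

section \<open>Full subcategories and the identity equivalence\<close>

lemma full_sub_simps [simp]:
  "Ob (full_sub C S) = Ob C \<inter> S"
  "Hom (full_sub C S) = Hom C"
  "Ident (full_sub C S) = Ident C"
  "Comp (full_sub C S) = Comp C"
  by (simp_all add: full_sub_def)

lemma is_categoryD:
  assumes "is_category C"
  shows "\<And>X. X \<in> Ob C \<Longrightarrow> Ident C X \<in> Hom C X X"
    and "\<And>X Y Z f g. X \<in> Ob C \<Longrightarrow> Y \<in> Ob C \<Longrightarrow> Z \<in> Ob C \<Longrightarrow> f \<in> Hom C X Y \<Longrightarrow> g \<in> Hom C Y Z \<Longrightarrow>
           Comp C X Y Z g f \<in> Hom C X Z"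
    and "\<And>X Y f. X \<in> Ob C \<Longrightarrow> Y \<in> Ob C \<Longrightarrow> f \<in> Hom C X Y \<Longrightarrow> Comp C X Y Y (Ident C Y) f = f"
    and "\<And>X Y f. X \<in> Ob C \<Longrightarrow> Y \<in> Ob C \<Longrightarrow> f \<in> Hom C X Y \<Longrightarrow> Comp C X X Y f (Ident C X) = f"
    and "\<And>W X Y Z f g h. W \<in> Ob C \<Longrightarrow> X \<in> Ob C \<Longrightarrow> Y \<in> Ob C \<Longrightarrow> Z \<in> Ob C \<Longrightarrow>
           f \<in> Hom C W X \<Longrightarrow> g \<in> Hom C X Y \<Longrightarrow> h \<in> Hom C Y Z \<Longrightarrow>
           Comp C W Y Z h (Comp C W X Y g f) = Comp C W X Z (Comp C X Y Z h g) f"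
  using assms unfolding is_category_def by blast+

lemma full_sub_category: "is_category C \<Longrightarrow> is_category (full_sub C S)"
  unfolding is_category_def full_sub_simps by blast

lemma functor_id_simps [simp]: "on_ob functor_id X = X" "on_hom functor_id X Y f = f"
  by (simp_all add: functor_id_def)

lemma functor_comp_simps [simp]:
  "on_ob (functor_comp G F) X = on_ob G (on_ob F X)"
  "on_hom (functor_comp G F) X Y f = on_hom G (on_ob F X) (on_ob F Y) (on_hom F X Y f)"
  by (simp_all add: functor_comp_def)

lemma is_iso_Ident: "is_category C \<Longrightarrow> X \<in> Ob C \<Longrightarrow> is_iso C X X (Ident C X)"
  unfolding is_iso_def using is_categoryD(1,3) by metis

lemma naturally_isomorphic_refl:
  assumes "is_functor C D F"
  shows "naturally_isomorphic C D F F"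
  unfolding naturally_isomorphic_def nat_trans_def
  using assms unfolding is_functor_def
  by (intro exI[of _ "\<lambda>X. Ident D (on_ob F X)"])
    (simp add: is_categoryD is_iso_Ident)

text \<open>Identity functors serve in both directions and commute strictly with the inclusions.
  This case is enough for the theorem because the subcategories to be compared turn out to be
  equal.\<close>

lemma equivalent_subcats_refl:
  assumes "is_category C"
  shows "equivalent_subcats C S S"
proof -
  have "functor_comp functor_id functor_id = functor_id"
    by (simp add: functor_comp_def functor_id_def)
  moreover have "is_functor (full_sub C S) (full_sub C S) functor_id"
      "is_functor (full_sub C S) C functor_id"
    using assms full_sub_category[OF assms] by (auto simp: is_functor_def is_categoryD)
  ultimately show ?thesis
    unfolding equivalent_subcats_def is_equivalence_def
    by (metis naturally_isomorphic_refl)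
qed

section \<open>Adjunctions with a monic unit\<close>

text \<open>By naturality, \<open>g\<close> followed by \<open>\<eta> X\<close> equals
  \<open>\<eta> Z\<close> followed by \<open>G (F g)\<close>, and by uniqueness in the universal
  property of \<open>\<eta> Z\<close> that composite determines \<open>F g\<close>. So the unit
  identifies two maps into \<open>X\<close> exactly when \<open>F\<close> does, and membership in
  \<open>F_tr\<close> becomes a condition on \<open>tr n\<close> alone.\<close>

lemma right_adjoint_unit_mono_iff:
  assumes adj: "right_adjoint C D F G \<eta>" and X: "X \<in> Ob C"
  shows "is_mono C X (on_ob G (on_ob F X)) (\<eta> X) \<longleftrightarrow>
    (\<forall>Z\<in>Ob C. \<forall>g\<in>Hom C Z X. \<forall>h\<in>Hom C Z X. on_hom F Z X g = on_hom F Z X h \<longrightarrow> g = h)"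
proof -
  have F: "is_functor C D F" and G: "is_functor D C G"
    and nat: "nat_trans C C functor_id (functor_comp G F) \<eta>"
    and univ: "\<And>Z Y g. Z \<in> Ob C \<Longrightarrow> Y \<in> Ob D \<Longrightarrow> g \<in> Hom C Z (on_ob G Y) \<Longrightarrow>
        \<exists>!f. f \<in> Hom D (on_ob F Z) Y \<and>
          g = Comp C Z (on_ob G (on_ob F Z)) (on_ob G Y) (on_hom G (on_ob F Z) Y f) (\<eta> Z)"
    using adj unfolding right_adjoint_def by blast+
  have C: "is_category C" using F unfolding is_functor_def by blast
  have FX: "on_ob F X \<in> Ob D" using F X unfolding is_functor_def by blast
  have GFX: "on_ob G (on_ob F X) \<in> Ob C" using G FX unfolding is_functor_def by blast
  have \<eta>: "\<eta> X \<in> Hom C X (on_ob G (on_ob F X))"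
    using nat X unfolding nat_trans_def by simp
  have natural: "Comp C Z X (on_ob G (on_ob F X)) (\<eta> X) g =
      Comp C Z (on_ob G (on_ob F Z)) (on_ob G (on_ob F X))
        (on_hom G (on_ob F Z) (on_ob F X) (on_hom F Z X g)) (\<eta> Z)"
    if "Z \<in> Ob C" "g \<in> Hom C Z X" for Z g
    using nat X that unfolding nat_trans_def by simp
  have "Comp C Z X (on_ob G (on_ob F X)) (\<eta> X) g = Comp C Z X (on_ob G (on_ob F X)) (\<eta> X) h \<longleftrightarrow>
      on_hom F Z X g = on_hom F Z X h"
    if Z: "Z \<in> Ob C" and g: "g \<in> Hom C Z X" and h: "h \<in> Hom C Z X" for Z g h
  proof
    assume eq: "Comp C Z X (on_ob G (on_ob F X)) (\<eta> X) g = Comp C Z X (on_ob G (on_ob F X)) (\<eta> X) h"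
    have "on_hom F Z X g \<in> Hom D (on_ob F Z) (on_ob F X)"
      "on_hom F Z X h \<in> Hom D (on_ob F Z) (on_ob F X)"
      using F Z X g h unfolding is_functor_def by blast+
    then show "on_hom F Z X g = on_hom F Z X h"
      using univ[OF Z FX is_categoryD(2)[OF C Z X GFX g \<eta>]] natural[OF Z g] natural[OF Z h] eq
      by metis
  qed (simp add: natural[OF Z] g h)
  then show ?thesis
    unfolding is_mono_def using \<eta> by blast
qed

text \<open>Faithfulness of \<open>F\<close> on maps into an object is transported along an
  isomorphism: two maps into \<open>Y\<close> with the same image under \<open>F\<close> are
  composed with \<open>g\<close>, compared in \<open>X\<close>, and brought back by
  \<open>f\<close>.\<close>

lemma replete_unit_mono:
  assumes adj: "right_adjoint C D F G \<eta>"
  shows "replete C {X \<in> Ob C. is_mono C X (on_ob G (on_ob F X)) (\<eta> X)}"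
  unfolding replete_def
proof (intro ballI impI CollectI conjI)
  fix X Y assume "X \<in> {X \<in> Ob C. is_mono C X (on_ob G (on_ob F X)) (\<eta> X)}"
    and Y: "Y \<in> Ob C" and "isomorphic C X Y"
  then obtain f g where X: "X \<in> Ob C" and f: "f \<in> Hom C X Y" and g: "g \<in> Hom C Y X"
    and fg: "Comp C Y X Y f g = Ident C Y"
    and mono: "is_mono C X (on_ob G (on_ob F X)) (\<eta> X)"
    unfolding isomorphic_def is_iso_def by blast
  have F: "is_functor C D F" using adj unfolding right_adjoint_def by blast
  then have C: "is_category C" unfolding is_functor_def by blast
  have "a = b" if Z: "Z \<in> Ob C" and a: "a \<in> Hom C Z Y" and b: "b \<in> Hom C Z Y"
    and eq: "on_hom F Z Y a = on_hom F Z Y b" for Z a b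
  proof -
    have "on_hom F Z X (Comp C Z Y X g a) = on_hom F Z X (Comp C Z Y X g b)"
      using F Z Y X a b g eq unfolding is_functor_def by simp
    then have "Comp C Z Y X g a = Comp C Z Y X g b"
      using mono is_categoryD(2)[OF C Z Y X _ g] a b Z
      unfolding right_adjoint_unit_mono_iff[OF adj X] by blast
    then have "Comp C Z Y Y (Comp C Y X Y f g) a = Comp C Z Y Y (Comp C Y X Y f g) b"
      using is_categoryD(5)[OF C Z Y X Y _ g f] a b by metis
    then show ?thesis
      using is_categoryD(3)[OF C Z Y] a b fg by simp
  qed
  then show "is_mono C Y (on_ob G (on_ob F Y)) (\<eta> Y)"
    unfolding right_adjoint_unit_mono_iff[OF adj Y] by blast
qed simp

section \<open>Zero maps and zero objects among simplicial groups\<close>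

definition zero_hom :: "nat set \<Rightarrow> 'a simplicial \<Rightarrow> 'a simplicial \<Rightarrow> nat \<Rightarrow> 'a \<Rightarrow> 'a" where
  "zero_hom D X Y = (\<lambda>k\<in>D. \<lambda>x\<in>carrier (grp X k). \<one>\<^bsub>grp Y k\<^esub>)"

lemma zero_hom_apply [simp]:
  "k \<in> D \<Longrightarrow> x \<in> carrier (grp X k) \<Longrightarrow> zero_hom D X Y k x = \<one>\<^bsub>grp Y k\<^esub>"
  by (simp add: zero_hom_def)

lemma simplicial_act_one:
  assumes "simplicial_group_on D X" "k \<in> D" "l \<in> D" "\<theta> \<in> Delta k l"
  shows "act X k l \<theta> \<one>\<^bsub>grp X l\<^esub> = \<one>\<^bsub>grp X k\<^esub>"
  using assms simplicial_groupD(1,2)[OF assms(1)] by (simp add: hom_one)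

lemma simplicial_hom_one:
  assumes "simplicial_group_on D X" "simplicial_group_on D Y" "f \<in> simplicial_hom D X Y" "k \<in> D"
  shows "f k \<one>\<^bsub>grp X k\<^esub> = \<one>\<^bsub>grp Y k\<^esub>"
  using assms simplicial_groupD(1) simplicial_homD(1) by (blast intro: hom_one)

lemma simplicial_one_closed:
  "simplicial_group_on D X \<Longrightarrow> k \<in> D \<Longrightarrow> \<one>\<^bsub>grp X k\<^esub> \<in> carrier (grp X k)"
  using simplicial_groupD(1) group.is_monoid monoid.one_closed by blast

lemma zero_hom_Hom:
  assumes X: "simplicial_group_on D X" and Y: "simplicial_group_on D Y"
  shows "zero_hom D X Y \<in> simplicial_hom D X Y"
proof (rule simplicial_homI)
  fix k assume k: "k \<in> D"
  interpret X: group "grp X k" using simplicial_groupD(1)[OF X k] .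
  interpret Y: group "grp Y k" using simplicial_groupD(1)[OF Y k] .
  show "zero_hom D X Y k \<in> hom (grp X k) (grp Y k)"
    using k by (auto simp: hom_def)
qed (use simplicial_groupD(3)[OF X] simplicial_act_one[OF Y] in \<open>auto simp: zero_hom_def\<close>)

lemma is_zero_SimpGrp_iff:
  fixes Z :: "'a simplicial"
  shows "is_zero (SimpGrp_on D) Z \<longleftrightarrow>
     simplicial_group_on D Z \<and> (\<forall>k\<in>D. carrier (grp Z k) = {\<one>\<^bsub>grp Z k\<^esub>})"
proof (intro iffI conjI ballI)
  assume zero: "is_zero (SimpGrp_on D) Z"
  then show Z: "simplicial_group_on D Z" by (simp add: is_zero_def SimpGrp_simps)
  \<comment> \<open>Both sides are endomorphisms of \<open>Z\<close>, and a zero object has only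
    one. Evaluation at \<open>x\<close> then reads \<open>x = 1\<close>.\<close>
  have eq: "zero_hom D Z Z = (\<lambda>k\<in>D. \<lambda>x\<in>carrier (grp Z k). x)"
    using zero zero_hom_Hom[OF Z Z] simplicial_Ident[OF Z] Z
    unfolding is_zero_def SimpGrp_simps by blast
  fix k assume k: "k \<in> D"
  have "x = \<one>\<^bsub>grp Z k\<^esub>" if "x \<in> carrier (grp Z k)" for x
    using fun_cong[OF fun_cong[OF eq, of k], of x] k that by simp
  then show "carrier (grp Z k) = {\<one>\<^bsub>grp Z k\<^esub>}"
    using simplicial_one_closed[OF Z k] by blast
next
  assume Z': "simplicial_group_on D Z \<and> (\<forall>k\<in>D. carrier (grp Z k) = {\<one>\<^bsub>grp Z k\<^esub>})"
  then have Z: "simplicial_group_on D Z"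
    and triv: "\<And>k x. k \<in> D \<Longrightarrow> x \<in> carrier (grp Z k) \<Longrightarrow> x = \<one>\<^bsub>grp Z k\<^esub>" by auto
  show "is_zero (SimpGrp_on D) Z"
    unfolding is_zero_def SimpGrp_simps
  proof (intro conjI ballI CollectI Z)
    fix X :: "'a simplicial" assume "X \<in> {X. simplicial_group_on D X}"
    then have X: "simplicial_group_on D X" by simp
    show "\<exists>!f. f \<in> simplicial_hom D X Z"
    proof (rule ex1I[of _ "zero_hom D X Z"])
      fix f assume f: "f \<in> simplicial_hom D X Z"
      show "f = zero_hom D X Z"
        by (rule simplicial_hom_eqI[OF f zero_hom_Hom[OF X Z]])
          (simp add: triv simplicial_homD(2)[OF f])
    qed (rule zero_hom_Hom[OF X Z])
    show "\<exists>!f. f \<in> simplicial_hom D Z X"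
    proof (rule ex1I[of _ "zero_hom D Z X"])
      fix f assume f: "f \<in> simplicial_hom D Z X"
      have "f k x = zero_hom D Z X k x" if k: "k \<in> D" and x: "x \<in> carrier (grp Z k)" for k x
        using simplicial_hom_one[OF Z X f k] triv[OF k x] zero_hom_apply[of k D x Z X, OF k x]
        by simp
      then show "f = zero_hom D Z X"
        by (rule simplicial_hom_eqI[OF f zero_hom_Hom[OF Z X]])
    qed (rule zero_hom_Hom[OF Z X])
  qed
qed

text \<open>One-point groups in every degree; \<open>undefined\<close> is an element at hand in
  every type \<open>'a\<close>.\<close>

lemma ex_zero_SimpGrp: "\<exists>Z. is_zero (SimpGrp_on D) Z"
proof -
  define Z :: "'a simplicial" where
    "Z = \<lparr>grp = (\<lambda>k. \<lparr>carrier = {undefined}, mult = (\<lambda>x y. undefined), one = undefined\<rparr>),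
          act = (\<lambda>k l \<theta> x. undefined)\<rparr>"
  have "group (grp Z k)" for k by (rule groupI) (auto simp: Z_def)
  then have "is_zero (SimpGrp_on D) Z"
    unfolding is_zero_SimpGrp_iff simplicial_group_on_def by (auto simp: Z_def hom_def)
  then show ?thesis ..
qed

text \<open>A map through a zero object passes through a trivial group in each degree, whichever
  zero object is chosen. Zero morphisms can thus be recognised elementwise instead of through an
  existential over objects.\<close>

lemma zero_mor_SimpGrp_iff:
  assumes X: "simplicial_group_on D X" and Y: "simplicial_group_on D Y"
  shows "zero_mor (SimpGrp_on D) X Y f \<longleftrightarrow> f = zero_hom D X Y"
proof
  assume "zero_mor (SimpGrp_on D) X Y f"
  then obtain Z a b where zero: "is_zero (SimpGrp_on D) Z"
    and a: "a \<in> simplicial_hom D X Z" and b: "b \<in> simplicial_hom D Z Y"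
    and f: "f = (\<lambda>k\<in>D. compose (carrier (grp X k)) (b k) (a k))"
    unfolding zero_mor_def SimpGrp_simps by blast
  have Z: "simplicial_group_on D Z" using zero by (simp add: is_zero_SimpGrp_iff)
  have "a k x = \<one>\<^bsub>grp Z k\<^esub>" if "k \<in> D" "x \<in> carrier (grp X k)" for k x
    using simplicial_homD(2)[OF a that] zero that by (auto simp: is_zero_SimpGrp_iff)
  then show "f = zero_hom D X Y"
    unfolding f
    by (intro simplicial_hom_eqI[OF simplicial_Comp[OF X a b] zero_hom_Hom[OF X Y]])
      (simp add: compose_def simplicial_hom_one[OF Z Y b])
next
  assume f: "f = zero_hom D X Y"
  obtain Z :: "'a simplicial" where zero: "is_zero (SimpGrp_on D) Z"
    using ex_zero_SimpGrp by blast
  then have Z: "simplicial_group_on D Z" by (simp add: is_zero_SimpGrp_iff)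
  have "f = (\<lambda>k\<in>D. compose (carrier (grp X k)) (zero_hom D Z Y k) (zero_hom D X Z k))"
    unfolding f
    by (rule simplicial_hom_eqI[OF zero_hom_Hom[OF X Y]
          simplicial_Comp[OF X zero_hom_Hom[OF X Z] zero_hom_Hom[OF Z Y]]])
      (simp add: compose_def simplicial_one_closed[OF Z])
  then show "zero_mor (SimpGrp_on D) X Y f"
    unfolding zero_mor_def SimpGrp_simps
    using zero zero_hom_Hom[OF X Z] zero_hom_Hom[OF Z Y] by blast
qed

text \<open>Each \<open>x\<close> equals \<open>g (f x)\<close>, while \<open>f x\<close> lies in a
  trivial group and \<open>g\<close> preserves units.\<close>

lemma isomorphic_zero_SimpGrp:
  assumes X: "simplicial_group_on D X" and "isomorphic (SimpGrp_on D) X Z"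
    and zero: "is_zero (SimpGrp_on D) Z"
  shows "is_zero (SimpGrp_on D) X"
proof -
  obtain f g where f: "f \<in> simplicial_hom D X Z" and g: "g \<in> simplicial_hom D Z X"
    and gf: "(\<lambda>k\<in>D. compose (carrier (grp X k)) (g k) (f k)) = (\<lambda>k\<in>D. \<lambda>x\<in>carrier (grp X k). x)"
    using assms(2) unfolding isomorphic_def is_iso_def SimpGrp_simps by blast
  have Z: "simplicial_group_on D Z" using zero by (simp add: is_zero_SimpGrp_iff)
  have "x = \<one>\<^bsub>grp X k\<^esub>" if k: "k \<in> D" and x: "x \<in> carrier (grp X k)" for k x
  proof -
    have "x = g k (f k x)"
      using fun_cong[OF fun_cong[OF gf, of k], of x] k x by (simp add: compose_def)
    also have "f k x = \<one>\<^bsub>grp Z k\<^esub>"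
      using simplicial_homD(2)[OF f k x] zero k by (auto simp: is_zero_SimpGrp_iff)
    finally show ?thesis using simplicial_hom_one[OF Z X g k] by simp
  qed
  then show ?thesis
    using X simplicial_one_closed[OF X] unfolding is_zero_SimpGrp_iff by blast
qed

section \<open>Trivial truncation and trivial Moore complex\<close>

text \<open>A truncation isomorphic to a zero object is itself one; conversely it can serve as its
  own witness \<open>Z\<close>.\<close>

lemma T_tr_iff:
  "X \<in> T_tr n \<longleftrightarrow>
     simplicial_group_on UNIV X \<and> (\<forall>k\<le>n. carrier (grp X k) = {\<one>\<^bsub>grp X k\<^esub>})"
proof (cases "simplicial_group_on UNIV X")
  case True
  note tX = tr_Ob[OF True, of n]
  have "isomorphic (TrSimpGrp n) (on_ob (tr n) X) (on_ob (tr n) X)"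
    unfolding isomorphic_def using is_iso_Ident[OF SimpGrp_category] tX
    by (metis SimpGrp_simps(1) mem_Collect_eq)
  then have "X \<in> T_tr n \<longleftrightarrow> is_zero (TrSimpGrp n) (on_ob (tr n) X)"
    using True isomorphic_zero_SimpGrp[OF tX] by (auto simp: T_tr_def SimpGrp_simps(1))
  then show ?thesis
    using True tX by (auto simp: is_zero_SimpGrp_iff tr_simps)
qed (simp add: T_tr_def SimpGrp_simps)

text \<open>Positivity matters: at \<open>k = 0\<close> the truncated difference
  \<open>k - 1\<close> is 0, and \<open>coface 0 0\<close> sends 0 to 1, outside
  \<open>{..0}\<close>.\<close>

lemma coface_Delta: "0 < k \<Longrightarrow> coface k i \<in> Delta (k - 1) k"
  by (auto simp: coface_def Delta_def mono_on_def)

text \<open>The bound in \<open>M_ge\<close> is strict, so \<open>n + 1\<close> covers exactly the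
  degrees up to \<open>n\<close>. Equality of the two classes reduces every later comparison to
  reflexivity.\<close>

lemma M_ge_eq_T_tr: "M_ge (n + 1) = T_tr n"
proof (rule Set.set_eqI)
  fix X :: "'a simplicial"
  have one: "\<one>\<^bsub>moore X k\<^esub> = \<one>\<^bsub>grp X k\<^esub>" for k by (simp add: moore_def)
  have moore_sub: "carrier (moore X k) \<subseteq> carrier (grp X k)" for k
    by (auto simp: moore_def kernel_def)
  show "X \<in> M_ge (n + 1) \<longleftrightarrow> X \<in> T_tr n"
  proof (cases "simplicial_group_on UNIV X")
    case X: True
    note one_closed = simplicial_one_closed[OF X UNIV_I]
    have one_moore: "\<one>\<^bsub>grp X k\<^esub> \<in> carrier (moore X k)" for k
      using one_closed simplicial_act_one[OF X UNIV_I UNIV_I coface_Delta]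
      by (auto simp: moore_def kernel_def face_def)
    have "carrier (grp X k) = {\<one>\<^bsub>grp X k\<^esub>}"
      if "k \<le> n" and triv: "\<forall>i<n + 1. carrier (moore X i) = {\<one>\<^bsub>moore X i\<^esub>}" for k
      using \<open>k \<le> n\<close>
    proof (induction k rule: less_induct)
      case (less k)
      \<comment> \<open>By induction the group in degree \<open>k - 1\<close> is trivial, so each
        face on degree \<open>k\<close> takes only the value 1 and its kernel is everything. In
        degree 0 the Moore complex is the whole group by definition.\<close>
      have "carrier (grp X k) \<subseteq> carrier (moore X k)"
      proof (cases "k = 0")
        case False
        then have "carrier (grp X (k - 1)) = {\<one>\<^bsub>grp X (k - 1)\<^esub>}" using less by simp
        then have "face X k i x = \<one>\<^bsub>grp X (k - 1)\<^esub>" if "x \<in> carrier (grp X k)" for i x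
          using simplicial_groupD(3)[OF X UNIV_I UNIV_I coface_Delta that] False
          by (simp add: face_def)
        then show ?thesis using False by (auto simp: moore_def kernel_def)
      qed (simp add: moore_def)
      then show ?case using triv less.prems moore_sub[of k] one[of k] by auto
    qed
    moreover have "carrier (moore X k) = {\<one>\<^bsub>moore X k\<^esub>}"
      if "carrier (grp X k) = {\<one>\<^bsub>grp X k\<^esub>}" for k
      using that moore_sub[of k] one_moore[of k] one[of k] by auto
    ultimately show ?thesis
      using X by (auto simp: M_ge_def T_tr_iff SimpGrp_simps)
  qed (simp add: M_ge_def T_tr_def SimpGrp_simps)
qed

section \<open>Quotients by normal simplicial subgroups\<close>

text \<open>Normality allows a quotient group in each degree; stability lets the operators restrict
  to the subgroups and descend to the quotients.\<close>

locale normal_simplicial_subgroup =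
  fixes D :: "nat set" and X :: "'a simplicial" and A :: "nat \<Rightarrow> 'a set"
  assumes simplicial: "simplicial_group_on D X"
    and normal: "k \<in> D \<Longrightarrow> A k \<lhd> grp X k"
    and stable: "k \<in> D \<Longrightarrow> l \<in> D \<Longrightarrow> \<theta> \<in> Delta k l \<Longrightarrow> x \<in> A l \<Longrightarrow> act X k l \<theta> x \<in> A k"
begin

definition sub_ob :: "'a simplicial" where
  "sub_ob = \<lparr>grp = (\<lambda>k. (grp X k)\<lparr>carrier := A k\<rparr>), act = act X\<rparr>"

definition incl :: "nat \<Rightarrow> 'a \<Rightarrow> 'a" where
  "incl = (\<lambda>k\<in>D. \<lambda>x\<in>A k. x)"

text \<open>
  The quotient must again live in \<open>'a\<close>, so cosets are replaced by chosen representatives.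
\<close>

definition rep :: "nat \<Rightarrow> 'a \<Rightarrow> 'a" where
  "rep k x = (SOME y. y \<in> A k #>\<^bsub>grp X k\<^esub> x)"

text \<open>The outer \<open>rep\<close> normalises: a product of representatives, or the image of
  one under an operator, need not be a chosen representative. Up to this relabelling it is the usual
  degreewise quotient.\<close>

definition quot_ob :: "'a simplicial" where
  "quot_ob = \<lparr>grp = (\<lambda>k. \<lparr>carrier = rep k ` carrier (grp X k),
        mult = (\<lambda>x y. rep k (x \<otimes>\<^bsub>grp X k\<^esub> y)), one = rep k \<one>\<^bsub>grp X k\<^esub>\<rparr>),
      act = (\<lambda>k l \<theta> x. rep k (act X k l \<theta> x))\<rparr>"

definition proj :: "nat \<Rightarrow> 'a \<Rightarrow> 'a" where
  "proj = (\<lambda>k\<in>D. \<lambda>x\<in>carrier (grp X k). rep k x)"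

lemma sub_ob_simps [simp]:
  "carrier (grp sub_ob k) = A k" "mult (grp sub_ob k) = mult (grp X k)"
  "\<one>\<^bsub>grp sub_ob k\<^esub> = \<one>\<^bsub>grp X k\<^esub>" "act sub_ob = act X"
  by (simp_all add: sub_ob_def)

lemma quot_ob_simps [simp]:
  "carrier (grp quot_ob k) = rep k ` carrier (grp X k)"
  "x \<otimes>\<^bsub>grp quot_ob k\<^esub> y = rep k (x \<otimes>\<^bsub>grp X k\<^esub> y)"
  "\<one>\<^bsub>grp quot_ob k\<^esub> = rep k \<one>\<^bsub>grp X k\<^esub>"
  "act quot_ob k l \<theta> x = rep k (act X k l \<theta> x)"
  by (simp_all add: quot_ob_def)

lemma incl_apply [simp]: "k \<in> D \<Longrightarrow> x \<in> A k \<Longrightarrow> incl k x = x"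
  by (simp add: incl_def)

lemma proj_apply [simp]: "k \<in> D \<Longrightarrow> x \<in> carrier (grp X k) \<Longrightarrow> proj k x = rep k x"
  by (simp add: proj_def)

lemma A_subset: "k \<in> D \<Longrightarrow> x \<in> A k \<Longrightarrow> x \<in> carrier (grp X k)"
  using normal subgroup.mem_carrier normal_imp_subgroup by metis

text \<open>The cosets are right cosets, so the correction factor from \<open>A k\<close> stands on
  the left.\<close>

lemma rep_eq:
  assumes k: "k \<in> D" and x: "x \<in> carrier (grp X k)"
  obtains a where "a \<in> A k" "rep k x = a \<otimes>\<^bsub>grp X k\<^esub> x"
proof -
  interpret normal "A k" "grp X k" using normal[OF k] .
  have "rep k x \<in> A k #>\<^bsub>grp X k\<^esub> x"
    unfolding rep_def by (rule someI[of _ x]) (rule rcos_self[OF x subgroup_axioms])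
  then show thesis using that by (auto simp: r_coset_def)
qed

lemma rep_closed: "k \<in> D \<Longrightarrow> x \<in> carrier (grp X k) \<Longrightarrow> rep k x \<in> carrier (grp X k)"
  using rep_eq A_subset simplicial_groupD(1)[OF simplicial] group.is_monoid monoid.m_closed by metis

text \<open>The choice made by \<open>rep\<close> depends only on the coset as a set, and both
  elements have the same coset.\<close>

lemma rep_cong_mult:
  assumes k: "k \<in> D" and a: "a \<in> A k" and x: "x \<in> carrier (grp X k)"
  shows "rep k (a \<otimes>\<^bsub>grp X k\<^esub> x) = rep k x"
proof -
  interpret normal "A k" "grp X k" using normal[OF k] .
  have "A k #>\<^bsub>grp X k\<^esub> (a \<otimes>\<^bsub>grp X k\<^esub> x) = A k #>\<^bsub>grp X k\<^esub> x"
    using a x by (simp add: coset_mult_assoc[symmetric] subset coset_join2 subgroup_axioms)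
  then show ?thesis by (simp add: rep_def)
qed

lemma rep_rep_mult:
  assumes k: "k \<in> D" and x: "x \<in> carrier (grp X k)" and y: "y \<in> carrier (grp X k)"
  shows "rep k (rep k x \<otimes>\<^bsub>grp X k\<^esub> rep k y) = rep k (x \<otimes>\<^bsub>grp X k\<^esub> y)"
proof -
  interpret normal "A k" "grp X k" using normal[OF k] .
  obtain a b where a: "a \<in> A k" "rep k x = a \<otimes>\<^bsub>grp X k\<^esub> x"
    and b: "b \<in> A k" "rep k y = b \<otimes>\<^bsub>grp X k\<^esub> y"
    using rep_eq k x y by metis
  \<comment> \<open>Normality moves \<open>b\<close> to the left past \<open>x\<close>:
    \<open>(a x)(b y) = a (x b x^-1) (x y)\<close>, and \<open>c\<close> collects the factors before
    \<open>x y\<close>.\<close>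
  define c where "c = a \<otimes>\<^bsub>grp X k\<^esub> (x \<otimes>\<^bsub>grp X k\<^esub> b \<otimes>\<^bsub>grp X k\<^esub> inv\<^bsub>grp X k\<^esub> x)"
  have "c \<in> A k" using a b x inv_op_closed2 unfolding c_def by auto
  moreover have "rep k x \<otimes>\<^bsub>grp X k\<^esub> rep k y = c \<otimes>\<^bsub>grp X k\<^esub> (x \<otimes>\<^bsub>grp X k\<^esub> y)"
  proof -
    have "inv\<^bsub>grp X k\<^esub> x \<otimes>\<^bsub>grp X k\<^esub> (x \<otimes>\<^bsub>grp X k\<^esub> y) = y"
      using x y by (simp add: m_assoc[symmetric])
    then show ?thesis using a b x y by (simp add: c_def m_assoc)
  qed
  ultimately show ?thesis using rep_cong_mult[OF k] x y by simp
qed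

lemma rep_rep: "k \<in> D \<Longrightarrow> x \<in> carrier (grp X k) \<Longrightarrow> rep k (rep k x) = rep k x"
  by (metis rep_eq rep_cong_mult)

text \<open>The operator carries the correction factor from \<open>A l\<close> into
  \<open>A k\<close> by stability, and there the outer \<open>rep\<close> absorbs it.\<close>

lemma rep_act_rep:
  assumes "k \<in> D" "l \<in> D" "\<theta> \<in> Delta k l" and x: "x \<in> carrier (grp X l)"
  shows "rep k (act X k l \<theta> (rep l x)) = rep k (act X k l \<theta> x)"
proof -
  obtain a where a: "a \<in> A l" "rep l x = a \<otimes>\<^bsub>grp X l\<^esub> x"
    using rep_eq[OF \<open>l \<in> D\<close> x] .
  have "act X k l \<theta> (rep l x) = act X k l \<theta> a \<otimes>\<^bsub>grp X k\<^esub> act X k l \<theta> x"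
    unfolding a(2)
    using hom_mult[OF simplicial_groupD(2)[OF simplicial assms(1-3)]] A_subset[OF _ a(1)] assms
    by blast
  then show ?thesis
    using rep_cong_mult stable simplicial_groupD(3)[OF simplicial] assms a(1) by metis
qed

text \<open>This identifies the kernel of the projection. If \<open>a x\<close> and
  \<open>b 1\<close> are the same representative, then \<open>x = a^-1 b\<close> lies in the
  subgroup.\<close>

lemma rep_eq_rep_one_iff:
  assumes k: "k \<in> D" and x: "x \<in> carrier (grp X k)"
  shows "rep k x = rep k \<one>\<^bsub>grp X k\<^esub> \<longleftrightarrow> x \<in> A k"
proof
  interpret normal "A k" "grp X k" using normal[OF k] .
  obtain a b where a: "a \<in> A k" "rep k x = a \<otimes>\<^bsub>grp X k\<^esub> x"
    and b: "b \<in> A k" "rep k \<one>\<^bsub>grp X k\<^esub> = b \<otimes>\<^bsub>grp X k\<^esub> \<one>\<^bsub>grp X k\<^esub>"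
    using rep_eq k x by (metis one_closed mem_carrier)
  show "x \<in> A k" if "rep k x = rep k \<one>\<^bsub>grp X k\<^esub>"
  proof -
    have "a \<otimes>\<^bsub>grp X k\<^esub> x = b" using that a b by simp
    then have "x = inv\<^bsub>grp X k\<^esub> a \<otimes>\<^bsub>grp X k\<^esub> b"
      using a(1) b(1) x inv_solve_left by simp
    then show ?thesis using a(1) b(1) by simp
  qed
  show "rep k x = rep k \<one>\<^bsub>grp X k\<^esub>" if "x \<in> A k"
    using rep_cong_mult[OF k that one_closed] x by simp
qed

lemma rep_hom: "k \<in> D \<Longrightarrow> rep k \<in> hom (grp X k) (grp quot_ob k)"
  by (auto simp: hom_def rep_rep_mult)

lemma sub_ob_simplicial: "simplicial_group_on D sub_ob"
proof -
  have "group (grp sub_ob k)" if "k \<in> D" for k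
    using subgroup.subgroup_is_group[OF normal_imp_subgroup[OF normal[OF that]]]
      simplicial_groupD(1)[OF simplicial that]
    by (simp add: sub_ob_def)
  moreover have "act X k l \<theta> \<in> hom (grp sub_ob l) (grp sub_ob k)"
    if "k \<in> D" "l \<in> D" "\<theta> \<in> Delta k l" for k l \<theta>
    using that stable hom_mult[OF simplicial_groupD(2)[OF simplicial that]] A_subset
    by (auto simp: hom_def)
  ultimately show ?thesis
    using simplicial_groupD(4,5)[OF simplicial] A_subset
    by (auto simp: simplicial_group_on_def)
qed

lemma quot_ob_simplicial: "simplicial_group_on D quot_ob"
proof -
  \<comment> \<open>The carrier is the image of a group under the homomorphism \<open>rep k\<close>,
    which supplies the group laws.\<close>
  have "group (grp quot_ob k)" if "k \<in> D" for k
    using group.hom_imp_img_group[OF simplicial_groupD(1)[OF simplicial that] rep_hom[OF that]]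
    by (simp add: quot_ob_def)
  moreover have "act quot_ob k l \<theta> \<in> hom (grp quot_ob l) (grp quot_ob k)"
    if D: "k \<in> D" "l \<in> D" "\<theta> \<in> Delta k l" for k l \<theta>
  proof -
    interpret group "grp X l" using simplicial_groupD(1)[OF simplicial D(2)] .
    note closed = simplicial_groupD(3)[OF simplicial D]
    show ?thesis
      using hom_mult[OF simplicial_groupD(2)[OF simplicial D]]
      by (auto simp: hom_def rep_rep_mult D closed rep_act_rep rep_closed)
  qed
  \<comment> \<open>\<open>rep_act_rep\<close> removes the inner representatives; what remains is
    functoriality of the action on \<open>X\<close>.\<close>
  moreover have "act quot_ob j l (compose {..j} \<phi> \<theta>) x = act quot_ob j k \<theta> (act quot_ob k l \<phi> x)"
    if "j \<in> D" "k \<in> D" "l \<in> D" "\<theta> \<in> Delta j k" "\<phi> \<in> Delta k l" "x \<in> carrier (grp quot_ob l)"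
    for j k l \<theta> \<phi> x
    using that rep_closed simplicial_groupD(3)[OF simplicial] Delta_compose
    by (auto simp: rep_act_rep simplicial_groupD(5)[OF simplicial, symmetric])
  moreover have "act quot_ob k k (\<lambda>j\<in>{..k}. j) x = x"
    if "k \<in> D" "x \<in> carrier (grp quot_ob k)" for k x
    using that simplicial_groupD(4)[OF simplicial] rep_closed by (auto simp: rep_rep)
  ultimately show ?thesis unfolding simplicial_group_on_def by blast
qed

lemma incl_Hom: "incl \<in> simplicial_hom D sub_ob X"
proof (rule simplicial_homI)
  fix k assume k: "k \<in> D"
  interpret normal "A k" "grp X k" using normal[OF k] .
  show "incl k \<in> hom (grp sub_ob k) (grp X k)"
    using k by (auto simp: hom_def)
qed (use stable in \<open>auto simp: incl_def\<close>)

lemma proj_Hom: "proj \<in> simplicial_hom D X quot_ob"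
proof (rule simplicial_homI)
  fix k assume k: "k \<in> D"
  interpret group "grp X k" using simplicial_groupD(1)[OF simplicial k] .
  show "proj k \<in> hom (grp X k) (grp quot_ob k)"
    using k by (auto simp: hom_def rep_rep_mult)
qed (auto simp: proj_def rep_act_rep simplicial_groupD(3)[OF simplicial])

lemma proj_incl:
  "(\<lambda>k\<in>D. compose (carrier (grp sub_ob k)) (proj k) (incl k)) = zero_hom D sub_ob quot_ob"
  by (rule simplicial_hom_eqI[OF simplicial_Comp[OF sub_ob_simplicial incl_Hom proj_Hom]
        zero_hom_Hom[OF sub_ob_simplicial quot_ob_simplicial]])
    (simp add: compose_def A_subset rep_eq_rep_one_iff)

lemma incl_kernel: "is_kernel (SimpGrp_on D) sub_ob X quot_ob incl proj"
  unfolding is_kernel_def SimpGrp_simps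
proof (intro conjI ballI impI incl_Hom proj_Hom)
  show "zero_mor (SimpGrp_on D) sub_ob quot_ob
      (\<lambda>k\<in>D. compose (carrier (grp sub_ob k)) (proj k) (incl k))"
    unfolding zero_mor_SimpGrp_iff[OF sub_ob_simplicial quot_ob_simplicial] by (rule proj_incl)
next
  fix Z g assume "Z \<in> {X. simplicial_group_on D X}" and g: "g \<in> simplicial_hom D Z X"
    and "zero_mor (SimpGrp_on D) Z quot_ob (\<lambda>k\<in>D. compose (carrier (grp Z k)) (proj k) (g k))"
  then have Z: "simplicial_group_on D Z"
    and eq: "(\<lambda>k\<in>D. compose (carrier (grp Z k)) (proj k) (g k)) = zero_hom D Z quot_ob"
    using zero_mor_SimpGrp_iff[OF _ quot_ob_simplicial] by auto
  have gA: "g k z \<in> A k" if k: "k \<in> D" and z: "z \<in> carrier (grp Z k)" for k z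
    using fun_cong[OF fun_cong[OF eq, of k], of z] k z simplicial_homD(2)[OF g k z]
    by (simp add: compose_def rep_eq_rep_one_iff)
  \<comment> \<open>The carriers of \<open>sub_ob\<close> are subsets of those of \<open>X\<close>,
    so the factorisation is \<open>g\<close> itself, read with a smaller codomain.\<close>
  have u: "g \<in> simplicial_hom D Z sub_ob"
  proof (rule simplicial_homI)
    fix k assume "k \<in> D"
    then show "g k \<in> hom (grp Z k) (grp sub_ob k)"
      using simplicial_homD(1)[OF g] gA by (auto simp: hom_def)
  qed (use simplicial_homD(3-5)[OF g] in auto)
  show "\<exists>!u. u \<in> simplicial_hom D Z sub_ob \<and>
      g = (\<lambda>k\<in>D. compose (carrier (grp Z k)) (incl k) (u k))"
  proof (intro ex1I[of _ g] conjI u)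
    show "g = (\<lambda>k\<in>D. compose (carrier (grp Z k)) (incl k) (g k))"
      by (rule simplicial_hom_eqI[OF g simplicial_Comp[OF Z u incl_Hom]]) (simp add: compose_def gA)
  next
    fix v assume v: "v \<in> simplicial_hom D Z sub_ob \<and>
      g = (\<lambda>k\<in>D. compose (carrier (grp Z k)) (incl k) (v k))"
    then have v': "v \<in> simplicial_hom D Z sub_ob" by simp
    have "v k z = g k z" if "k \<in> D" "z \<in> carrier (grp Z k)" for k z
      using v that simplicial_homD(2)[OF v' that] by (simp add: compose_def)
    then show "v = g" by (rule simplicial_hom_eqI[OF v' g])
  qed
qed

lemma proj_cokernel: "is_cokernel (SimpGrp_on D) sub_ob X quot_ob incl proj"
  unfolding is_cokernel_def SimpGrp_simps
proof (intro conjI ballI impI incl_Hom proj_Hom)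
  show "zero_mor (SimpGrp_on D) sub_ob quot_ob
      (\<lambda>k\<in>D. compose (carrier (grp sub_ob k)) (proj k) (incl k))"
    unfolding zero_mor_SimpGrp_iff[OF sub_ob_simplicial quot_ob_simplicial] by (rule proj_incl)
next
  fix Z g assume "Z \<in> {X. simplicial_group_on D X}" and g: "g \<in> simplicial_hom D X Z"
    and "zero_mor (SimpGrp_on D) sub_ob Z (\<lambda>k\<in>D. compose (carrier (grp sub_ob k)) (g k) (incl k))"
  then have Z: "simplicial_group_on D Z"
    and eq: "(\<lambda>k\<in>D. compose (carrier (grp sub_ob k)) (g k) (incl k)) = zero_hom D sub_ob Z"
    using zero_mor_SimpGrp_iff[OF sub_ob_simplicial] by auto
  have gA: "g k a = \<one>\<^bsub>grp Z k\<^esub>" if "k \<in> D" "a \<in> A k" for k a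
    using fun_cong[OF fun_cong[OF eq, of k], of a] that by (simp add: compose_def)
  \<comment> \<open>Since \<open>g\<close> kills \<open>A\<close>, it is constant on cosets. The
    induced map \<open>u\<close> on the quotient is therefore \<open>g\<close> restricted to
    representatives.\<close>
  have g_rep: "g k (rep k x) = g k x" if k: "k \<in> D" and x: "x \<in> carrier (grp X k)" for k x
  proof -
    interpret Z: group "grp Z k" using simplicial_groupD(1)[OF Z k] .
    obtain a where "a \<in> A k" "rep k x = a \<otimes>\<^bsub>grp X k\<^esub> x" using rep_eq[OF k x] .
    then show ?thesis
      using hom_mult[OF simplicial_homD(1)[OF g k]] A_subset gA k x simplicial_homD(2)[OF g k x]
      by simp
  qed
  define u where "u = (\<lambda>k\<in>D. \<lambda>y\<in>carrier (grp quot_ob k). g k y)"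
  have u_rep: "u k (rep k x) = g k x" if "k \<in> D" "x \<in> carrier (grp X k)" for k x
    using that by (simp add: u_def g_rep)
  have u: "u \<in> simplicial_hom D quot_ob Z"
  proof (rule simplicial_homI)
    fix k assume k: "k \<in> D"
    interpret group "grp X k" using simplicial_groupD(1)[OF simplicial k] .
    show "u k \<in> hom (grp quot_ob k) (grp Z k)"
      using k hom_mult[OF simplicial_homD(1)[OF g k]]
      by (auto simp: hom_def u_rep rep_rep_mult simplicial_homD(2)[OF g])
  next
    fix k l \<theta> y assume "k \<in> D" "l \<in> D" "\<theta> \<in> Delta k l" "y \<in> carrier (grp quot_ob l)"
    then show "u k (act quot_ob k l \<theta> y) = act Z k l \<theta> (u l y)"
      by (auto simp: u_rep rep_act_rep simplicial_homD(5)[OF g] simplicial_groupD(3)[OF simplicial])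
  qed (auto simp: u_def)
  show "\<exists>!u. u \<in> simplicial_hom D quot_ob Z \<and>
      g = (\<lambda>k\<in>D. compose (carrier (grp X k)) (u k) (proj k))"
  proof (intro ex1I[of _ u] conjI u)
    show "g = (\<lambda>k\<in>D. compose (carrier (grp X k)) (u k) (proj k))"
      by (rule simplicial_hom_eqI[OF g simplicial_Comp[OF simplicial proj_Hom u]])
        (simp add: compose_def u_rep)
  next
    fix v assume v: "v \<in> simplicial_hom D quot_ob Z \<and>
      g = (\<lambda>k\<in>D. compose (carrier (grp X k)) (v k) (proj k))"
    have "v k (rep k x) = g k x" if "k \<in> D" "x \<in> carrier (grp X k)" for k x
      using v that by (simp add: compose_def)
    then show "v = u"
      using v by (intro simplicial_hom_eqI[OF _ u]) (auto simp: u_rep)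
  qed
qed

lemma short_exact_quot: "short_exact (SimpGrp_on D) sub_ob X quot_ob incl proj"
  using incl_kernel proj_cokernel by (simp add: short_exact_def)

end

section \<open>The torsion theory of truncation\<close>

text \<open>The kernel of the unit of the coskeleton adjunction in degree \<open>k\<close>.\<close>

definition tr_kernel :: "nat \<Rightarrow> 'a simplicial \<Rightarrow> nat \<Rightarrow> 'a set" where
  "tr_kernel n X k =
     {x \<in> carrier (grp X k). \<forall>i\<le>n. \<forall>\<theta>\<in>Delta i k. act X i k \<theta> x = \<one>\<^bsub>grp X i\<^esub>}"

text \<open>In each degree this is an intersection of kernels of homomorphisms, hence normal. It is
  stable because an operator into degree \<open>i\<close> applied after \<open>\<theta>\<close> is
  again an operator into degree \<open>i\<close>, and so is among those that kill
  \<open>x\<close>.\<close>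

lemma tr_kernel_normal_simplicial_subgroup:
  assumes X: "simplicial_group_on UNIV X"
  shows "normal_simplicial_subgroup UNIV X (tr_kernel n X)"
proof (rule normal_simplicial_subgroup.intro)
  fix k
  interpret group "grp X k" using simplicial_groupD(1)[OF X] by simp
  have gh: "group_hom (grp X k) (grp X i) (act X i k \<theta>)" if "\<theta> \<in> Delta i k" for i \<theta>
    using simplicial_groupD(1,2)[OF X] that by (simp add: group_hom_def group_hom_axioms_def)
  have act_mult: "act X i k \<theta> (x \<otimes>\<^bsub>grp X k\<^esub> y) = act X i k \<theta> x \<otimes>\<^bsub>grp X i\<^esub> act X i k \<theta> y"
    if "\<theta> \<in> Delta i k" "x \<in> carrier (grp X k)" "y \<in> carrier (grp X k)" for i \<theta> x y
    using group_hom.hom_mult[OF gh] that by simp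
  have act_inv: "act X i k \<theta> (inv\<^bsub>grp X k\<^esub> x) = inv\<^bsub>grp X i\<^esub> act X i k \<theta> x"
    if "\<theta> \<in> Delta i k" "x \<in> carrier (grp X k)" for i \<theta> x
    using group_hom.hom_inv[OF gh] that by simp
  note closed = simplicial_groupD(3)[OF X UNIV_I UNIV_I]
  note G = simplicial_groupD(1)[OF X UNIV_I]
  note M = group.is_monoid[OF G]
  have "subgroup (tr_kernel n X k) (grp X k)"
    by (rule subgroup.intro)
      (auto simp: tr_kernel_def act_mult act_inv simplicial_act_one[OF X] G monoid.l_one[OF M]
        monoid.one_closed[OF M] monoid.inv_one[OF M])
  moreover have "x \<otimes>\<^bsub>grp X k\<^esub> h \<otimes>\<^bsub>grp X k\<^esub> inv\<^bsub>grp X k\<^esub> x \<in> tr_kernel n X k"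
    if "x \<in> carrier (grp X k)" "h \<in> tr_kernel n X k" for x h
    using that
    by (auto simp: tr_kernel_def act_mult act_inv closed monoid.r_one[OF M] group.r_inv[OF G])
  ultimately show "tr_kernel n X k \<lhd> grp X k"
    by (auto simp: normal_inv_iff)
next
  fix k l \<theta> x assume \<theta>: "\<theta> \<in> Delta k l" and x: "x \<in> tr_kernel n X l"
  then show "act X k l \<theta> x \<in> tr_kernel n X k"
    using simplicial_groupD(3)[OF X UNIV_I UNIV_I \<theta>] Delta_compose[OF _ \<theta>]
    by (auto simp: tr_kernel_def simplicial_groupD(5)[OF X UNIV_I UNIV_I UNIV_I _ \<theta>, symmetric])
qed (rule X)

lemma torsion_theory_tr:
  fixes cosk :: "('a simplicial, nat \<Rightarrow> 'a \<Rightarrow> 'a, 'a simplicial, nat \<Rightarrow> 'a \<Rightarrow> 'a) cfunctor"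
  assumes adj: "right_adjoint SimpGrp (TrSimpGrp n) (tr n) cosk \<eta>"
  shows "torsion_theory SimpGrp (T_tr n) (F_tr n cosk \<eta>)"
  unfolding torsion_theory_def
proof (intro conjI ballI SimpGrp_category ex_zero_SimpGrp)
  show "T_tr n \<subseteq> Ob SimpGrp" "F_tr n cosk \<eta> \<subseteq> Ob SimpGrp"
    by (auto simp: T_tr_def F_tr_def)
  show "replete SimpGrp (F_tr n cosk \<eta>)"
    unfolding F_tr_def by (rule replete_unit_mono[OF adj])
  show "replete SimpGrp (T_tr n :: 'a simplicial set)"
    unfolding replete_def
  proof (intro ballI impI)
    fix X Y :: "'a simplicial"
    assume X: "X \<in> T_tr n" and "Y \<in> Ob SimpGrp" and "isomorphic SimpGrp X Y"
    then obtain f g where Y: "simplicial_group_on UNIV Y" and f: "f \<in> simplicial_hom UNIV X Y"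
      and g: "g \<in> simplicial_hom UNIV Y X"
      and fg: "(\<lambda>k\<in>UNIV. compose (carrier (grp Y k)) (f k) (g k)) =
        (\<lambda>k\<in>UNIV. \<lambda>x\<in>carrier (grp Y k). x)"
      unfolding isomorphic_def is_iso_def SimpGrp_simps by blast
    have X': "simplicial_group_on UNIV X" using X by (simp add: T_tr_iff)
    have "y = \<one>\<^bsub>grp Y k\<^esub>" if "k \<le> n" and y: "y \<in> carrier (grp Y k)" for k y
    proof -
      have "y = f k (g k y)"
        using fun_cong[OF fun_cong[OF fg, of k], of y] y by (simp add: compose_def)
      also have "g k y = \<one>\<^bsub>grp X k\<^esub>"
        using simplicial_homD(2)[OF g UNIV_I y] X \<open>k \<le> n\<close> by (auto simp: T_tr_iff)
      finally show ?thesis using simplicial_hom_one[OF X' Y f UNIV_I] by simp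
    qed
    then show "Y \<in> T_tr n"
      using Y simplicial_one_closed[OF Y UNIV_I] unfolding T_tr_iff by blast
  qed
next
  fix X Y :: "'a simplicial" and f
  assume X: "X \<in> T_tr n" and Y: "Y \<in> F_tr n cosk \<eta>" and "f \<in> Hom SimpGrp X Y"
  then have X': "simplicial_group_on UNIV X" and Y': "simplicial_group_on UNIV Y"
    and f: "f \<in> simplicial_hom UNIV X Y"
    by (simp_all add: T_tr_def F_tr_def SimpGrp_simps)
  \<comment> \<open>In degrees up to \<open>n\<close> the source contains only units, and
    homomorphisms preserve units.\<close>
  have "on_hom (tr n) X Y f = on_hom (tr n) X Y (zero_hom UNIV X Y)"
  proof (rule simplicial_hom_eqI[OF tr_Hom[OF f] tr_Hom[OF zero_hom_Hom[OF X' Y']]])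
    fix k x assume "k \<in> {..n}" "x \<in> carrier (grp (on_ob (tr n) X) k)"
    then have k: "k \<le> n" "x = \<one>\<^bsub>grp X k\<^esub>" using X by (auto simp: tr_simps T_tr_iff)
    then show "on_hom (tr n) X Y f k x = on_hom (tr n) X Y (zero_hom UNIV X Y) k x"
      by (simp add: tr_simps simplicial_hom_one[OF X' Y' f] simplicial_one_closed[OF X'])
  qed
  then have "f = zero_hom UNIV X Y"
    using Y right_adjoint_unit_mono_iff[OF adj, of Y] f zero_hom_Hom[OF X' Y'] X'
    by (auto simp: F_tr_def SimpGrp_simps)
  then show "zero_mor SimpGrp X Y f"
    by (simp add: zero_mor_SimpGrp_iff[OF X' Y'])
next
  fix X :: "'a simplicial" assume "X \<in> Ob SimpGrp"
  then have X: "simplicial_group_on UNIV X" by (simp add: SimpGrp_simps)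
  interpret normal_simplicial_subgroup UNIV X "tr_kernel n X"
    by (rule tr_kernel_normal_simplicial_subgroup[OF X])
  \<comment> \<open>For \<open>k \<le> n\<close> the identity of \<open>[k]\<close> is one of the
    operators that must kill \<open>x\<close>.\<close>
  have tr_kernel_trivial: "x = \<one>\<^bsub>grp X k\<^esub>" if "k \<le> n" "x \<in> tr_kernel n X k" for k x
  proof -
    have "x \<in> carrier (grp X k)" "act X k k (\<lambda>j\<in>{..k}. j) x = \<one>\<^bsub>grp X k\<^esub>"
      using that by (auto simp: tr_kernel_def intro: Delta_id)
    then show ?thesis using simplicial_groupD(4)[OF X UNIV_I] by simp
  qed
  have "sub_ob \<in> T_tr n"
    using tr_kernel_trivial sub_ob_simplicial simplicial_one_closed[OF sub_ob_simplicial UNIV_I]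
    by (auto simp: T_tr_iff)
  moreover have "quot_ob \<in> F_tr n cosk \<eta>"
  proof -
    have "g = h" if Z: "simplicial_group_on UNIV Z" and g: "g \<in> simplicial_hom UNIV Z quot_ob"
      and h: "h \<in> simplicial_hom UNIV Z quot_ob"
      and eq: "on_hom (tr n) Z quot_ob g = on_hom (tr n) Z quot_ob h" for Z g h
    proof (rule simplicial_hom_eqI[OF g h])
      fix k z assume z: "z \<in> carrier (grp Z k)"
      interpret Q: group "grp quot_ob k" using simplicial_groupD(1)[OF quot_ob_simplicial] by simp
      \<comment> \<open>\<open>w\<close> measures how far \<open>g\<close> and \<open>h\<close>
        differ at \<open>z\<close>; the aim is to show that a lift \<open>x\<close> of it to
        \<open>X\<close> lies in the kernel.\<close>
      define w where "w = g k z \<otimes>\<^bsub>grp quot_ob k\<^esub> inv\<^bsub>grp quot_ob k\<^esub> h k z"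
      note gz = simplicial_homD(2)[OF g UNIV_I z] and hz = simplicial_homD(2)[OF h UNIV_I z]
      have "w \<in> carrier (grp quot_ob k)" unfolding w_def using gz hz by blast
      then obtain x where x: "x \<in> carrier (grp X k)" and w: "w = rep k x" by auto
      \<comment> \<open>In degrees up to \<open>n\<close> the maps \<open>g\<close> and
        \<open>h\<close> agree, so operators into these degrees send \<open>w\<close> to 1 in the
        quotient. For the lift \<open>x\<close> this says only that its image lies in the
        kernel.\<close>
      have "act X i k \<theta> x \<in> tr_kernel n X i" if i: "i \<le> n" and \<theta>: "\<theta> \<in> Delta i k" for i \<theta>
      proof -
        interpret Qi: group "grp quot_ob i"
          using simplicial_groupD(1)[OF quot_ob_simplicial] by simp
        interpret q: group_hom "grp quot_ob k" "grp quot_ob i" "act quot_ob i k \<theta>"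
          using simplicial_groupD(2)[OF quot_ob_simplicial UNIV_I UNIV_I \<theta>]
          by unfold_locales
        have "act Z i k \<theta> z \<in> carrier (grp Z i)"
          using simplicial_groupD(3)[OF Z UNIV_I UNIV_I \<theta> z] .
        moreover have "g i = h i"
          using fun_cong[OF eq, of i] i by (simp add: tr_simps)
        ultimately have "act quot_ob i k \<theta> (g k z) = act quot_ob i k \<theta> (h k z)"
          using simplicial_homD(5)[OF g UNIV_I UNIV_I \<theta> z]
            simplicial_homD(5)[OF h UNIV_I UNIV_I \<theta> z] by metis
        then have "act quot_ob i k \<theta> w = \<one>\<^bsub>grp quot_ob i\<^esub>"
          unfolding w_def using gz hz by (metis q.hom_mult q.hom_inv q.hom_closed Q.inv_closed Qi.r_inv)
        then have "rep i (act X i k \<theta> x) = rep i \<one>\<^bsub>grp X i\<^esub>"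
          unfolding w by (simp add: rep_act_rep \<theta> x)
        then show ?thesis
          using rep_eq_rep_one_iff simplicial_groupD(3)[OF X UNIV_I UNIV_I \<theta> x] by simp
      qed
      \<comment> \<open>The kernel is trivial in degrees up to \<open>n\<close>, so the images of
        \<open>x\<close> are 1 in \<open>X\<close> itself, not merely in the quotient. Hence
        \<open>x\<close> belongs to the kernel and \<open>w\<close> is trivial.\<close>
      then have "act X i k \<theta> x = \<one>\<^bsub>grp X i\<^esub>" if "i \<le> n" "\<theta> \<in> Delta i k" for i \<theta>
        using tr_kernel_trivial that by blast
      then have "x \<in> tr_kernel n X k" using x by (simp add: tr_kernel_def)
      then have "w = \<one>\<^bsub>grp quot_ob k\<^esub>" using w x rep_eq_rep_one_iff by simp
      then show "g k z = h k z"
        unfolding w_def using gz hz by (metis Q.inv_equality Q.inv_inv Q.inv_closed)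
    qed
    then show ?thesis
      using right_adjoint_unit_mono_iff[OF adj, of quot_ob] quot_ob_simplicial
      by (simp add: F_tr_def SimpGrp_simps)
  qed
  ultimately show "\<exists>A\<in>T_tr n. \<exists>B\<in>F_tr n cosk \<eta>. \<exists>t q. short_exact SimpGrp A X B t q"
    using short_exact_quot by blast
qed

theorem corollary6p2:
  fixes n :: nat
    and cosk :: "('a simplicial, nat \<Rightarrow> 'a \<Rightarrow> 'a, 'a simplicial, nat \<Rightarrow> 'a \<Rightarrow> 'a) cfunctor"
    and \<eta> :: "'a simplicial \<Rightarrow> nat \<Rightarrow> 'a \<Rightarrow> 'a"
  assumes "right_adjoint SimpGrp (TrSimpGrp n) (tr n) cosk \<eta>"
  shows "equivalent_subcats SimpGrp (M_ge (n + 1)) (T_tr n :: 'a simplicial set) \<and>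
         torsion_subcategory SimpGrp (M_ge (n + 1) :: 'a simplicial set) \<and>
         torsion_theories_iso SimpGrp
           (T_tr n, F_tr n cosk \<eta>) (M_ge (n + 1), F_tr n cosk \<eta>)"
  \<comment> \<open>After replacing \<open>M_ge (n + 1)\<close> by \<open>T_tr n\<close>, both
    torsion theories are the same pair, and reflexivity gives the equivalences of the torsion parts
    and of the torsion-free parts.\<close>
  using torsion_theory_tr[OF assms] equivalent_subcats_refl[OF SimpGrp_category]
  unfolding M_ge_eq_T_tr torsion_subcategory_def torsion_theories_iso_def by auto

end
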